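(* Let $n\ge 2$ and let $B_\rho$ denote the ball of radius $\rho$ centered at $0$ in $\mathbb R^n$. For all sufficiently small $\epsilon\in(0,1/8)$ there are a positive function $u_\epsilon\in W^{1,n}_0(B_1)$ and a nonnegative function $V_\epsilon$ on $B_1$ such that $u_\epsilon$ is a solution of $-\Delta_n u_\epsilon=V_\epsilon u_\epsilon^{n-1}$ in $B_1$, and such that the following hold. For every $r\in[1,\infty)$, $V_\epsilon\in L\log^{(n-1)/r}L(B_1)$ and $\|V_\epsilon\|_{(N_r),B_1}$ remains bounded as $\epsilon\to 0$; for $r=\infty$, $V_\epsilon\in L^1(B_1)$ and $\|V_\epsilon\|_{L^1(B_1)}$ remains bounded as $\epsilon\to0$. However: (A) for every $r\in[1,\infty)$, $\displaystyle \frac{\|u_\epsilon\|_{L^\infty(B_{1/2})}}{\|u_\epsilon\|_{E_{rn},B_1}}\to+\infty$ as $\epsilon\to0$; (B) $\displaystyle \frac{\sup_{B_{1/8}}u_\epsilon}{\inf_{B_{1/8}}u_\epsilon}\to+\infty$ as $\epsilon\to 0$. (Consequently, for $k=0$, the local bound $\|u\|_{L^\infty(B_R)}\le C(\|u\|_{E_{nr},B_{2R}}+k)$ fails for $r\in[1,\infty)$, and the Harnack inequality $\sup_{B_R}u\le C(\inf_{B_R}u+k)$ fails for $r\in[1,\infty]$, with constants $C$ that are non-decreasing functions of $\|V\|$.)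
   Context: $\Delta_n u=\operatorname{div}(|\nabla u|^{n-2}\nabla u)$ is the $n$-Laplacian. For $s>0$ let $N_s(t)=\int_0^t\log^{(n-1)/s}(\tau+1)\,d\tau$; for measurable $\Omega$, $\|V\|_{(N_s),\Omega}=\inf\{\lambda>0:\int_\Omega N_s(|V|/\lambda)\,dx\le1\}$ and $\|v\|_{E_s,\Omega}=\inf\{\lambda>0:\int_\Omega\left(\exp(|v/\lambda|^{s/(n-1)})-1\right)dx\le1\}$. $L\log^{(n-1)/r}L(\Omega)$ is the space of $V$ with $\int_\Omega|V|\log^{(n-1)/r}(|V|+1)\,dx<\infty$; for $r=\infty$ it is read as $L^1(\Omega)$. Solutions are weak solutions: $\int_{B_1}|\nabla u|^{n-2}\nabla u\cdot\nabla\phi\,dx=\int_{B_1}V u^{n-1}\phi\,dx$ for all $\phi\in C_0^\infty(B_1)$. *)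

theory Defs
  imports "HOL-Analysis.Analysis" "HOL-Probability.Essential_Supremum"
begin

text \<open>The dimension is \<open>n = CARD('n)\<close>; all function spaces are with respect to Lebesgue
  measure on \<open>\<Omega>\<close>, and functions are defined on the whole space but only their values on
  \<open>\<Omega>\<close> are used.\<close>

subsection \<open>Test functions and gradients\<close>

primrec Ck :: "nat \<Rightarrow> ('a::euclidean_space \<Rightarrow> real) \<Rightarrow> bool" where
  "Ck 0 f \<longleftrightarrow> continuous_on UNIV f"
| "Ck (Suc k) f \<longleftrightarrow>
     (\<forall>x. f differentiable (at x)) \<and> (\<forall>v. Ck k (\<lambda>x. frechet_derivative f (at x) v))"

text \<open>Elements of \<open>C_0^\<infinity>(\<Omega>)\<close>, extended by zero to the whole space.\<close>

definition test_functions :: "'a::euclidean_space set \<Rightarrow> ('a \<Rightarrow> real) set" where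
  "test_functions \<Omega> =
     {\<phi>. (\<forall>k. Ck k \<phi>) \<and> compact (closure {x. \<phi> x \<noteq> 0}) \<and> closure {x. \<phi> x \<noteq> 0} \<subseteq> \<Omega>}"

definition grad :: "(real ^ 'n \<Rightarrow> real) \<Rightarrow> real ^ 'n \<Rightarrow> real ^ 'n" where
  "grad f x = (\<chi> i. frechet_derivative f (at x) (axis i 1))"

subsection \<open>Sobolev spaces\<close>

definition in_Lp :: "real \<Rightarrow> 'a::euclidean_space set \<Rightarrow> ('a \<Rightarrow> 'b::euclidean_space) \<Rightarrow> bool" where
  "in_Lp p \<Omega> f \<longleftrightarrow> f \<in> borel_measurable (lebesgue_on \<Omega>) \<and>
     integrable (lebesgue_on \<Omega>) (\<lambda>x. norm (f x) powr p)"

definition Lp_norm :: "real \<Rightarrow> 'a::euclidean_space set \<Rightarrow> ('a \<Rightarrow> 'b::euclidean_space) \<Rightarrow> real" where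
  "Lp_norm p \<Omega> f = (integral\<^sup>L (lebesgue_on \<Omega>) (\<lambda>x. norm (f x) powr p)) powr (1 / p)"

definition locally_integrable ::
    "'a::euclidean_space set \<Rightarrow> ('a \<Rightarrow> 'b::euclidean_space) \<Rightarrow> bool" where
  "locally_integrable \<Omega> f \<longleftrightarrow> (\<forall>K. compact K \<and> K \<subseteq> \<Omega> \<longrightarrow> integrable (lebesgue_on K) f)"

definition weak_gradient ::
    "(real ^ 'n) set \<Rightarrow> (real ^ 'n \<Rightarrow> real) \<Rightarrow> (real ^ 'n \<Rightarrow> real ^ 'n) \<Rightarrow> bool" where
  "weak_gradient \<Omega> u G \<longleftrightarrow> locally_integrable \<Omega> u \<and> locally_integrable \<Omega> G \<and>
     (\<forall>\<phi>\<in>test_functions \<Omega>.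
        integral\<^sup>L (lebesgue_on \<Omega>) (\<lambda>x. u x *\<^sub>R grad \<phi> x) =
        - integral\<^sup>L (lebesgue_on \<Omega>) (\<lambda>x. \<phi> x *\<^sub>R G x))"

text \<open>\<open>W_0^{1,p}(\<Omega>)\<close>: the closure of the test functions in \<open>W^{1,p}(\<Omega>)\<close>.\<close>

definition W0_1p :: "real \<Rightarrow> (real ^ 'n) set \<Rightarrow> (real ^ 'n \<Rightarrow> real) set" where
  "W0_1p p \<Omega> = {u. \<exists>G. in_Lp p \<Omega> u \<and> in_Lp p \<Omega> G \<and> weak_gradient \<Omega> u G \<and>
     (\<exists>\<phi>. (\<forall>k::nat. \<phi> k \<in> test_functions \<Omega>) \<and>
        (\<lambda>k. Lp_norm p \<Omega> (\<lambda>x. \<phi> k x - u x)) \<longlonglongrightarrow> 0 \<and>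
        (\<lambda>k. Lp_norm p \<Omega> (\<lambda>x. grad (\<phi> k) x - G x)) \<longlonglongrightarrow> 0)}"

subsection \<open>Weak solutions of \<open>-\<Delta>\<^sub>n u = V u^{n-1}\<close>\<close>

text \<open>The weak gradient is unique up to null sets, so the choice of \<open>G\<close> is immaterial.
  Integrability is required because the Bochner integral of a non-integrable function is 0.\<close>

definition weak_solution ::
    "(real ^ 'n) set \<Rightarrow> (real ^ 'n \<Rightarrow> real) \<Rightarrow> (real ^ 'n \<Rightarrow> real) \<Rightarrow> bool" where
  "weak_solution \<Omega> V u \<longleftrightarrow> (\<exists>G. weak_gradient \<Omega> u G \<and>
     (\<forall>\<phi>\<in>test_functions \<Omega>.
        integrable (lebesgue_on \<Omega>) (\<lambda>x. norm (G x) ^ (CARD('n) - 2) * (G x \<bullet> grad \<phi> x)) \<and>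
        integrable (lebesgue_on \<Omega>) (\<lambda>x. V x * u x ^ (CARD('n) - 1) * \<phi> x) \<and>
        integral\<^sup>L (lebesgue_on \<Omega>) (\<lambda>x. norm (G x) ^ (CARD('n) - 2) * (G x \<bullet> grad \<phi> x)) =
        integral\<^sup>L (lebesgue_on \<Omega>) (\<lambda>x. V x * u x ^ (CARD('n) - 1) * \<phi> x)))"

definition positive_W0_solution :: "(real ^ 'n \<Rightarrow> real) \<Rightarrow> (real ^ 'n \<Rightarrow> real) \<Rightarrow> bool" where
  "positive_W0_solution V u \<longleftrightarrow>
     u \<in> W0_1p (real CARD('n)) (ball 0 1) \<and> (\<forall>x\<in>ball 0 1. 0 < u x) \<and>
     V \<in> borel_measurable (lebesgue_on (ball 0 1)) \<and> (\<forall>x\<in>ball 0 1. 0 \<le> V x) \<and>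
     weak_solution (ball 0 1) V u"

subsection \<open>Orlicz norms and essential bounds\<close>

text \<open>Values in \<^typ>\<open>ereal\<close>, so that the infimum of the empty set is \<open>\<infinity>\<close>.\<close>

definition luxemburg_norm ::
    "(real \<Rightarrow> real) \<Rightarrow> 'a::euclidean_space set \<Rightarrow> ('a \<Rightarrow> real) \<Rightarrow> ereal" where
  "luxemburg_norm \<Phi> \<Omega> v =
     Inf {ereal c | c. 0 < c \<and> (\<integral>\<^sup>+x. ennreal (\<Phi> (\<bar>v x\<bar> / c)) \<partial>lebesgue_on \<Omega>) \<le> 1}"

definition N_fun :: "nat \<Rightarrow> real \<Rightarrow> real \<Rightarrow> real" where
  "N_fun n s t = integral {0..t} (\<lambda>\<tau>. ln (\<tau> + 1) powr ((real n - 1) / s))"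

definition N_norm :: "real \<Rightarrow> (real ^ 'n) set \<Rightarrow> (real ^ 'n \<Rightarrow> real) \<Rightarrow> ereal" where
  "N_norm s = luxemburg_norm (N_fun CARD('n) s)"

definition E_norm :: "real \<Rightarrow> (real ^ 'n) set \<Rightarrow> (real ^ 'n \<Rightarrow> real) \<Rightarrow> ereal" where
  "E_norm s = luxemburg_norm (\<lambda>t. exp (t powr (s / (real CARD('n) - 1))) - 1)"

definition LlogL :: "real \<Rightarrow> (real ^ 'n) set \<Rightarrow> (real ^ 'n \<Rightarrow> real) set" where
  "LlogL r \<Omega> = {V. V \<in> borel_measurable (lebesgue_on \<Omega>) \<and>
     integrable (lebesgue_on \<Omega>) (\<lambda>x. \<bar>V x\<bar> * ln (\<bar>V x\<bar> + 1) powr ((real CARD('n) - 1) / r))}"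

definition ess_sup :: "'a::euclidean_space set \<Rightarrow> ('a \<Rightarrow> real) \<Rightarrow> ereal" where
  "ess_sup \<Omega> u = esssup (lebesgue_on \<Omega>) (\<lambda>x. ereal (u x))"

definition ess_inf :: "'a::euclidean_space set \<Rightarrow> ('a \<Rightarrow> real) \<Rightarrow> ereal" where
  "ess_inf \<Omega> u = - esssup (lebesgue_on \<Omega>) (\<lambda>x. - ereal (u x))"

definition Linf_norm :: "'a::euclidean_space set \<Rightarrow> ('a \<Rightarrow> real) \<Rightarrow> ereal" where
  "Linf_norm \<Omega> u = ess_sup \<Omega> (\<lambda>x. \<bar>u x\<bar>)"

end

theory Submission
  imports Defs
begin

text \<open>The counterexamples are the Moser functions: \<open>u\<^sub>\<epsilon>\<close> equals \<open>log (1/|x|)\<close>, which is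
  \<open>n\<close>-harmonic away from the origin, for \<open>|x| \<ge> \<epsilon>\<close>, and inside \<open>|x| < \<epsilon>\<close> it is continued by the
  tangent paraboloid. As a function of \<open>|x|\<^sup>2\<close> it is \<open>C\<^sup>1\<close>, and \<open>-\<Delta>\<^sub>n u\<^sub>\<epsilon>\<close> is a bounded function
  \<open>f\<^sub>\<epsilon> \<le> C \<epsilon>\<^sup>-\<^sup>n\<close> supported in \<open>|x| < \<epsilon>\<close>. There \<open>u\<^sub>\<epsilon> \<ge> L = log (1/\<epsilon>)\<close>, so
  \<open>V\<^sub>\<epsilon> = f\<^sub>\<epsilon> / u\<^sub>\<epsilon>\<^sup>n\<^sup>-\<^sup>1\<close> gains the factor \<open>L\<^sup>-\<^sup>(\<^sup>n\<^sup>-\<^sup>1\<^sup>)\<close>, which compensates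
  \<open>log\<^sup>(\<^sup>n\<^sup>-\<^sup>1\<^sup>)\<^sup>/\<^sup>r V\<^sub>\<epsilon>\<close> for every \<open>r \<ge> 1\<close>. On the other hand \<open>sup u\<^sub>\<epsilon> \<ge> L\<close>, whereas \<open>u\<^sub>\<epsilon>\<close> is bounded
  on \<open>1/16 < |x| < 1/8\<close> and, by \<open>u\<^sub>\<epsilon> \<le> min (2L) (log (1/|x|))\<close>, the norm in \<open>E\<^sub>r\<^sub>n\<close> is at most
  \<open>C L\<^sup>1\<^sup>-\<^sup>1\<^sup>/\<^sup>q\<close> with \<open>q = rn/(n-1)\<close>.\<close>

section \<open>Functions of class \<open>C\<^sup>k\<close>\<close>

text \<open>Truncating the logarithm at a constant height would turn \<open>-\<Delta>_n u\<close>
  into a measure on the sphere \<open>|x| = \<epsilon>\<close>; the tangent cap keeps the gradient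
  continuous, so the source is a function with at most a jump there. The flux is
  \<open>-h(|x|) x\<close>, where \<open>h = r^-n\<close> outside the cap, so that the divergence
  \<open>n h + r h'\<close> vanishes, and \<open>h\<close> is a multiple of \<open>r^(n-2)\<close>
  inside. Two regularity gaps shape the proof. The profile \<open>h\<close> has a corner at
  \<open>\<epsilon>\<close>, so integration by parts is needed for Lipschitz fields; against a
  compactly supported test function no boundary term arises, and difference quotients suffice.
  Moreover \<open>u\<close> is only \<open>C^1\<close> and reaches the unit sphere with nonzero
  slope, whereas membership in \<open>W0_1p\<close> asks for smooth approximants supported strictly
  inside; these are built from polynomials and the flat exponential. The ratio in (A) is at least a
  multiple of \<open>L^(1/q)\<close>, where \<open>q = rn/(n-1)\<close>, and the ratio in (B) at
  least a multiple of \<open>L\<close>. The first rate degenerates as \<open>r\<close> tends to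
  infinity, which is why (A) concerns finite \<open>r\<close> only.\<close>

lemma Ck_SucI:
  fixes f :: "'a::euclidean_space \<Rightarrow> real"
  assumes "\<And>x. (f has_derivative f' x) (at x)" and "\<And>v. Ck k (\<lambda>x. f' x v)"
  shows "Ck (Suc k) f"
proof -
  have "frechet_derivative f (at x) = f' x" for x
    using frechet_derivative_at[OF assms(1)] by simp
  then show ?thesis
    using assms by (auto simp: differentiable_def)
qed

lemma Ck_SucD:
  assumes "Ck (Suc k) f"
  shows "(f has_derivative frechet_derivative f (at x)) (at x)"
    and "Ck k (\<lambda>x. frechet_derivative f (at x) v)"
  using assms by (auto simp: frechet_derivative_works[symmetric])

lemma Ck_Suc_imp_Ck: "Ck (Suc k) f \<Longrightarrow> Ck k f"
proof (induction k arbitrary: f)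
  case 0
  then show ?case
    by (auto intro!: continuous_at_imp_continuous_on differentiable_imp_continuous_within)
next
  case (Suc k)
  have "\<forall>x. f differentiable (at x)"
    and "\<forall>v. Ck (Suc k) (\<lambda>x. frechet_derivative f (at x) v)"
    using Suc.prems[unfolded Ck.simps(2)[of "Suc k"]] by blast+
  then show ?case
    using Suc.IH by simp
qed

lemma Ck_imp_continuous: "Ck k f \<Longrightarrow> continuous_on UNIV f"
proof (induction k)
  case (Suc k)
  then show ?case using Ck_Suc_imp_Ck by blast
qed simp

lemma Ck_const: "Ck k (\<lambda>x. c)"
proof (induction k arbitrary: c)
  case (Suc k)
  show ?case
    by (rule Ck_SucI[where f' = "\<lambda>x v. 0"]) (auto intro: Suc)
qed simp

lemma Ck_bounded_linear:
  assumes "bounded_linear f"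
  shows "Ck k f"
proof (cases k)
  case 0
  then show ?thesis
    using assms by (simp add: linear_continuous_on)
next
  case (Suc j)
  show ?thesis
    unfolding Suc
    by (rule Ck_SucI[where f' = "\<lambda>x. f"]) (auto intro: Ck_const bounded_linear_imp_has_derivative assms)
qed

lemma Ck_add: "Ck k f \<Longrightarrow> Ck k g \<Longrightarrow> Ck k (\<lambda>x. f x + g x)"
proof (induction k arbitrary: f g)
  case 0
  then show ?case by (simp add: continuous_on_add)
next
  case (Suc k)
  show ?case
    by (rule Ck_SucI[where f' = "\<lambda>x v. frechet_derivative f (at x) v + frechet_derivative g (at x) v"])
      (intro has_derivative_add Suc.IH Ck_SucD[OF Suc.prems(1)] Ck_SucD[OF Suc.prems(2)])+
qed

lemma Ck_mult: "Ck k f \<Longrightarrow> Ck k g \<Longrightarrow> Ck k (\<lambda>x. f x * g x)"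
proof (induction k arbitrary: f g)
  case 0
  then show ?case by (simp add: continuous_on_mult)
next
  case (Suc k)
  show ?case
    by (rule Ck_SucI[where f' = "\<lambda>x v. f x * frechet_derivative g (at x) v + frechet_derivative f (at x) v * g x"])
      (intro has_derivative_mult Ck_add Suc.IH Ck_SucD[OF Suc.prems(1)] Ck_SucD[OF Suc.prems(2)]
        Ck_Suc_imp_Ck[OF Suc.prems(1)] Ck_Suc_imp_Ck[OF Suc.prems(2)])+
qed

lemma Ck_compose:
  fixes h :: "real \<Rightarrow> real"
  shows "Ck k h \<Longrightarrow> Ck k f \<Longrightarrow> Ck k (\<lambda>x. h (f x))"
proof (induction k arbitrary: h f)
  case 0
  then show ?case
    by (auto intro: continuous_on_compose2[of UNIV h])
next
  case (Suc k)
  let ?h' = "\<lambda>y. frechet_derivative h (at y) 1"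
  \<comment> \<open>In one real variable the derivative is multiplication by \<open>?h' y\<close>.
    This separates the direction from the base point, so the chain rule yields a product to which
    the induction applies.\<close>
  have lin: "frechet_derivative h (at y) v = v * ?h' y" for y v
  proof -
    have "linear (frechet_derivative h (at y))"
      using Suc.prems(1) by (simp add: linear_frechet_derivative)
    from linear_cmul[OF this, of v 1] show ?thesis by simp
  qed
  show ?case
  proof (rule Ck_SucI[where f' = "\<lambda>x v. frechet_derivative f (at x) v * ?h' (f x)"])
    fix x
    show "((\<lambda>x. h (f x)) has_derivative (\<lambda>v. frechet_derivative f (at x) v * ?h' (f x))) (at x)"
      using has_derivative_compose[OF Ck_SucD(1)[OF Suc.prems(2)] Ck_SucD(1)[OF Suc.prems(1)]]
      by (simp add: lin[symmetric])
    show "Ck k (\<lambda>x. frechet_derivative f (at x) v * ?h' (f x))" for v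
      by (rule Ck_mult[OF Ck_SucD(2)[OF Suc.prems(2)]
            Suc.IH[OF Ck_SucD(2)[OF Suc.prems(1)] Ck_Suc_imp_Ck[OF Suc.prems(2)]]])
  qed
qed

lemma Ck_polynomial: "real_polynomial_function p \<Longrightarrow> Ck k p"
  by (induction rule: real_polynomial_function.induct)
    (auto intro: Ck_bounded_linear Ck_const Ck_add Ck_mult)

lemma Ck_real_antiderivative:
  fixes F :: "real \<Rightarrow> real"
  assumes "\<And>y. (F has_real_derivative g y) (at y)" and "\<And>k. Ck k g"
  shows "Ck k F"
proof -
  have "Ck (Suc k) F"
    by (rule Ck_SucI[where f' = "\<lambda>y. (*) (g y)"])
      (use assms in \<open>auto simp: has_field_derivative_def intro!: Ck_mult Ck_const\<close>)
  then show ?thesis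
    by (rule Ck_Suc_imp_Ck)
qed

text \<open>The powers of \<open>y\<close> in the denominator close the family under
  differentiation: each derivative is a combination of two members, so induction on the order proves
  smoothness for all \<open>m\<close> at once. The cutoff itself uses \<open>m = 0\<close>.\<close>

definition flat_exp :: "nat \<Rightarrow> real \<Rightarrow> real" where
  "flat_exp m y = (if 0 < y then exp (- 1 / y) / y ^ m else 0)"

lemma flat_exp_tendsto_0: "(flat_exp m \<longlongrightarrow> 0) (at 0)"
proof -
  have "((\<lambda>y::real. inverse y ^ m / exp (inverse y)) \<longlongrightarrow> 0) (at_right 0)"
    by (rule filterlim_compose[OF tendsto_power_div_exp_0 filterlim_inverse_at_top_right])
  then have "(flat_exp m \<longlongrightarrow> 0) (at_right 0)"
    by (rule Lim_transform_eventually)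
      (auto simp: eventually_at_filter flat_exp_def exp_minus field_simps)
  moreover have "(flat_exp m \<longlongrightarrow> 0) (at_left 0)"
    by (rule Lim_transform_eventually[where f="\<lambda>_. 0"])
      (auto simp: eventually_at_filter flat_exp_def)
  ultimately show ?thesis
    by (simp add: filterlim_at_split)
qed

lemma flat_exp_has_derivative:
  "(flat_exp m has_real_derivative flat_exp (m + 2) y - real m * flat_exp (m + 1) y) (at y)"
proof (cases y "0::real" rule: linorder_cases)
  case less
  have "((\<lambda>_. 0) has_real_derivative 0) (at y)" by simp
  then have "(flat_exp m has_real_derivative 0) (at y)"
    by (rule has_field_derivative_transform_within_open[where S="{..<0}"])
      (use less in \<open>auto simp: flat_exp_def\<close>)
  then show ?thesis
    using less by (simp add: flat_exp_def)
next
  case equal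
  \<comment> \<open>The difference quotient at the origin is \<open>flat_exp (Suc m)\<close>, whose
    limit is already known to be 0.\<close>
  have "((\<lambda>h. (flat_exp m (0 + h) - flat_exp m 0) / h) \<longlongrightarrow> 0) (at 0)"
    by (rule Lim_transform_eventually[OF flat_exp_tendsto_0[of "Suc m"]])
      (auto simp: eventually_at_filter flat_exp_def)
  then show ?thesis
    unfolding DERIV_def using equal by (simp add: flat_exp_def)
next
  case greater
  have "((\<lambda>y. exp (- 1 / y) / y ^ m) has_real_derivative
      flat_exp (m + 2) y - real m * flat_exp (m + 1) y) (at y)"
    using greater
    by (auto intro!: derivative_eq_intros simp: flat_exp_def)
      (cases m; auto simp: field_simps power2_eq_square)
  then show ?thesis
    by (rule has_field_derivative_transform_within_open[where S="{0<..}"])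
      (use greater in \<open>auto simp: flat_exp_def\<close>)
qed

lemma Ck_flat_exp: "Ck k (flat_exp m)"
proof (induction k arbitrary: m)
  case 0
  show ?case
    by (auto intro!: continuous_at_imp_continuous_on DERIV_isCont flat_exp_has_derivative)
next
  case (Suc k)
  show ?case
  proof (rule Ck_SucI)
    fix y
    show "(flat_exp m has_derivative (\<lambda>v. (flat_exp (m + 2) y + (- real m) * flat_exp (m + 1) y) * v)) (at y)"
      using flat_exp_has_derivative[of m y] by (simp add: has_field_derivative_def)
    show "Ck k (\<lambda>y. (flat_exp (m + 2) y + (- real m) * flat_exp (m + 1) y) * v)" for v
      by (intro Ck_mult Ck_add Ck_const Suc)
  qed
qed

lemma flat_exp_0_bounds: "0 \<le> flat_exp 0 y" "flat_exp 0 y \<le> 1"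
  by (auto simp: flat_exp_def)

text \<open>From \<open>exp z \<ge> 1 + z\<close>. An argument of size at least
  \<open>1/\<delta>\<close> thus brings the cutoff within \<open>\<delta>\<close> of 1.\<close>

lemma flat_exp_0_ge: "0 < y \<Longrightarrow> 1 - 1 / y \<le> flat_exp 0 y"
  using exp_ge_add_one_self[of "- 1 / y"] by (simp add: flat_exp_def)

section \<open>Integration by parts\<close>

text \<open>The class is closed under products, admits the corner of the flux profile, and still
  gives one constant that dominates all difference quotients of a compactly supported
  function.\<close>

definition lipschitz_on_balls :: "('a::euclidean_space \<Rightarrow> real) \<Rightarrow> bool" where
  "lipschitz_on_balls f \<longleftrightarrow> (\<forall>b. \<exists>L. L-lipschitz_on (cball 0 b) f)"

lemma lipschitz_on_balls_imp_continuous: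
  assumes "lipschitz_on_balls f"
  shows "continuous_on UNIV f"
proof (rule continuous_at_imp_continuous_on, rule ballI)
  fix x :: 'a
  obtain L where "L-lipschitz_on (cball 0 (norm x + 1)) f"
    using assms unfolding lipschitz_on_balls_def by blast
  then have "continuous_on (ball 0 (norm x + 1)) f"
    by (meson ball_subset_cball lipschitz_on_continuous_on lipschitz_on_subset)
  then show "isCont f x"
    by (simp add: continuous_on_eq_continuous_at)
qed

lemma lipschitz_on_balls_mult:
  fixes f g :: "'a::euclidean_space \<Rightarrow> real"
  assumes "lipschitz_on_balls f" "lipschitz_on_balls g"
  shows "lipschitz_on_balls (\<lambda>x. f x * g x)"
  unfolding lipschitz_on_balls_def
proof
  fix b
  obtain L M where L: "L-lipschitz_on (cball 0 b) f" and M: "M-lipschitz_on (cball 0 b) g"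
    using assms unfolding lipschitz_on_balls_def by blast
  have "bounded (f ` cball 0 b)" "bounded (g ` cball 0 b)"
    using L M by (auto intro!: compact_imp_bounded compact_continuous_image lipschitz_on_continuous_on)
  then obtain A B where A: "\<And>x. x \<in> cball 0 b \<Longrightarrow> \<bar>f x\<bar> \<le> A" "A > 0"
    and B: "\<And>x. x \<in> cball 0 b \<Longrightarrow> \<bar>g x\<bar> \<le> B" "B > 0"
    unfolding bounded_pos real_norm_def by (meson image_eqI)
  have "(A * M + B * L)-lipschitz_on (cball 0 b) (\<lambda>x. f x * g x)"
  proof (rule lipschitz_onI)
    fix x y :: 'a assume x: "x \<in> cball 0 b" and y: "y \<in> cball 0 b"
    have "f x * g x - f y * g y = f x * (g x - g y) + (f x - f y) * g y"
      by (simp add: algebra_simps)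
    then have "\<bar>f x * g x - f y * g y\<bar> \<le> \<bar>f x\<bar> * \<bar>g x - g y\<bar> + \<bar>f x - f y\<bar> * \<bar>g y\<bar>"
      by (metis abs_mult abs_triangle_ineq)
    also have "\<dots> \<le> A * (M * dist x y) + (L * dist x y) * B"
      using lipschitz_onD[OF L x y] lipschitz_onD[OF M x y] A B x y
      by (intro add_mono mult_mono) (auto simp: dist_real_def lipschitz_on_nonneg[OF L])
    finally show "dist (f x * g x) (f y * g y) \<le> (A * M + B * L) * dist x y"
      by (simp add: dist_real_def algebra_simps)
  qed (use lipschitz_on_nonneg[OF L] lipschitz_on_nonneg[OF M] A B in auto)
  then show "\<exists>L. L-lipschitz_on (cball 0 b) (\<lambda>x. f x * g x)" by blast
qed

lemma lipschitz_on_balls_C1: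
  fixes f :: "'a::euclidean_space \<Rightarrow> real"
  assumes "\<And>x. (f has_derivative (\<lambda>v. G x \<bullet> v)) (at x)" "continuous_on UNIV G"
  shows "lipschitz_on_balls f"
  unfolding lipschitz_on_balls_def
proof
  fix b
  have "bounded (G ` cball 0 b)"
    by (intro compact_imp_bounded compact_continuous_image continuous_on_subset[OF assms(2)]) auto
  then obtain C where C: "\<And>x. x \<in> cball 0 b \<Longrightarrow> norm (G x) \<le> C" "C > 0"
    unfolding bounded_pos by blast
  have "C-lipschitz_on (cball 0 b) f"
  proof (rule bounded_derivative_imp_lipschitz)
    show "(f has_derivative (\<lambda>v. G x \<bullet> v)) (at x within cball 0 b)" for x
      using assms(1) has_derivative_at_withinI by blast
    show "onorm (\<lambda>v. G x \<bullet> v) \<le> C" if "x \<in> cball 0 b" for x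
    proof (rule onorm_bound)
      show "norm (G x \<bullet> v) \<le> C * norm v" for v
        using Cauchy_Schwarz_ineq2[of "G x" v] C(1)[OF that]
        by (metis mult_right_mono norm_ge_zero order_trans real_norm_def)
    qed (use C in auto)
  qed (use C in auto)
  then show "\<exists>L. L-lipschitz_on (cball 0 b) f" by blast
qed

lemma integrable_lebesgue_compact_support:
  fixes f :: "'a::euclidean_space \<Rightarrow> 'b::euclidean_space"
  assumes "continuous_on UNIV f" "\<And>x. R < norm x \<Longrightarrow> f x = 0"
  shows "integrable lebesgue f"
proof -
  have "integrable lborel (\<lambda>x. indicator (cball 0 R) x *\<^sub>R f x)"
    by (rule borel_integrable_compact) (auto intro: continuous_on_subset[OF assms(1)])
  moreover have "(\<lambda>x. indicator (cball 0 R) x *\<^sub>R f x) = f"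
    using assms(2) by (force simp: indicator_def)
  ultimately show ?thesis
    using borel_measurable_continuous_onI[OF assms(1)] by (simp add: integrable_completion)
qed

lemma integral_lebesgue_shift:
  fixes f :: "'a::euclidean_space \<Rightarrow> real"
  assumes "continuous_on UNIV f"
  shows "integral\<^sup>L lebesgue (\<lambda>x. f (x + c)) = integral\<^sup>L lebesgue f"
proof -
  have m: "f \<in> borel_measurable borel"
    by (rule borel_measurable_continuous_onI[OF assms])
  have "integral\<^sup>L lebesgue f = integral\<^sup>L (distr lborel borel ((+) c)) f"
    using m by (simp add: integral_completion lborel_distr_plus)
  also have "\<dots> = integral\<^sup>L lborel (\<lambda>x. f (c + x))"
    by (rule integral_distr) (use m in auto)
  also have "\<dots> = integral\<^sup>L lebesgue (\<lambda>x. f (x + c))"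
    using m by (subst integral_completion) (auto simp: add.commute)
  finally show ?thesis by simp
qed

text \<open>By translation invariance every difference quotient of \<open>w\<close> has integral \<open>0\<close>; the
  Lipschitz bound dominates them.\<close>

lemma integral_directional_derivative_eq_0:
  fixes w :: "'a::euclidean_space \<Rightarrow> real" and v :: 'a
  assumes lip: "lipschitz_on_balls w"
    and supp: "\<And>x. R < norm x \<Longrightarrow> w x = 0"
    and meas: "D \<in> borel_measurable lebesgue"
    and deriv: "AE x in lebesgue. ((\<lambda>t. w (x + t *\<^sub>R v)) has_real_derivative D x) (at 0)"
  shows "integrable lebesgue D" and "integral\<^sup>L lebesgue D = 0"
proof -
  define t where "t k = inverse (real (Suc k))" for k
  have t: "0 < t k" "t k \<le> 1" for k
    by (auto simp: t_def field_simps)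
  have t0: "t \<longlonglongrightarrow> 0"
    unfolding t_def by (rule LIMSEQ_inverse_real_of_nat)
  define s where "s k x = (w (x + t k *\<^sub>R v) - w x) / t k" for k x
  have cw: "continuous_on UNIV w"
    by (rule lipschitz_on_balls_imp_continuous[OF lip])
  have cws: "continuous_on UNIV (\<lambda>x. w (x + a))" for a :: 'a
    by (rule continuous_on_compose2[OF cw]) (auto intro!: continuous_intros)
  \<comment> \<open>Since \<open>t k \<le> 1\<close>, the quotients vanish outside radius
    \<open>R + norm v\<close>, and inside it both compared points lie within radius
    \<open>R + 2 * norm v\<close>.\<close>
  obtain L where L: "L-lipschitz_on (cball 0 (R + 2 * norm v)) w"
    using lip unfolding lipschitz_on_balls_def by blast
  define B where "B x = indicator (cball 0 (R + norm v)) x * (L * norm v)" for x :: 'a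
  have L0: "0 \<le> L" using lipschitz_on_nonneg[OF L] .
  have bound: "norm (s k x) \<le> B x" for k and x :: 'a
  proof (cases "norm x \<le> R + norm v")
    case True
    have "norm (t k *\<^sub>R v) \<le> norm v"
      using t[of k] by (simp add: mult_left_le_one_le)
    then have "norm (x + t k *\<^sub>R v) \<le> R + 2 * norm v"
      using True norm_triangle_ineq[of x "t k *\<^sub>R v"] by linarith
    moreover have "norm x \<le> R + 2 * norm v"
      using True by (smt (verit) norm_ge_zero)
    ultimately have "dist (w (x + t k *\<^sub>R v)) (w x) \<le> L * dist (x + t k *\<^sub>R v) x"
      by (intro lipschitz_onD[OF L]) auto
    then have "\<bar>w (x + t k *\<^sub>R v) - w x\<bar> \<le> L * (t k * norm v)"
      using t[of k] by (simp add: dist_norm)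
    then show ?thesis
      using t[of k] True by (simp add: s_def B_def field_simps)
  next
    case False
    have "norm (t k *\<^sub>R v) \<le> norm v"
      using t[of k] by (simp add: mult_left_le_one_le)
    then have "R < norm (x + t k *\<^sub>R v)"
      using False norm_triangle_ineq4[of "x + t k *\<^sub>R v" "t k *\<^sub>R v"] by simp
    moreover have "R < norm x" using False by (smt (verit) norm_ge_zero)
    ultimately show ?thesis using L0 by (simp add: s_def B_def supp)
  qed
  have ws: "integrable lebesgue w" "integrable lebesgue (\<lambda>x. w (x + t k *\<^sub>R v))" for k
  proof -
    show "integrable lebesgue w"
      by (rule integrable_lebesgue_compact_support[OF cw supp])
    show "integrable lebesgue (\<lambda>x. w (x + t k *\<^sub>R v))"
    proof (rule integrable_lebesgue_compact_support[OF cws, where R="R + norm (t k *\<^sub>R v)"])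
      fix x :: 'a assume "R + norm (t k *\<^sub>R v) < norm x"
      then have "R < norm (x + t k *\<^sub>R v)"
        using norm_triangle_ineq4[of "x + t k *\<^sub>R v" "t k *\<^sub>R v"] by simp
      then show "w (x + t k *\<^sub>R v) = 0" by (rule supp)
    qed
  qed
  have ints: "integral\<^sup>L lebesgue (s k) = 0" for k
    unfolding s_def using ws by (simp add: integral_lebesgue_shift[OF cw])
  have lim: "AE x in lebesgue. (\<lambda>k. s k x) \<longlonglongrightarrow> D x"
    using deriv
  proof eventually_elim
    case (elim x)
    then have "((\<lambda>h. (w (x + h *\<^sub>R v) - w x) / h) \<longlongrightarrow> D x) (at 0)"
      by (simp add: DERIV_def)
    moreover have "filterlim t (at 0) sequentially"
      using t0 t by (simp add: filterlim_at less_imp_neq[symmetric])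
    ultimately show ?case
      unfolding s_def by (rule filterlim_compose)
  qed
  have sm: "s k \<in> borel_measurable lebesgue" for k
    unfolding s_def using ws by (intro borel_measurable_divide borel_measurable_diff) auto
  have "integrable lebesgue (indicator (cball 0 (R + norm v)) :: 'a \<Rightarrow> real)"
    using emeasure_bounded_finite[of "cball 0 (R + norm v)"]
    by (intro integrable_real_indicator) simp_all
  then have Bi: "integrable lebesgue B"
    unfolding B_def by (rule integrable_mult_left)
  show "integrable lebesgue D"
    by (rule integrable_dominated_convergence[OF meas sm Bi lim]) (use bound in auto)
  have "(\<lambda>k. integral\<^sup>L lebesgue (s k)) \<longlonglongrightarrow> integral\<^sup>L lebesgue D"
    by (rule integral_dominated_convergence[OF meas sm Bi lim]) (use bound in auto)
  then show "integral\<^sup>L lebesgue D = 0"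
    by (simp add: ints LIMSEQ_const_iff)
qed

lemma has_real_derivative_along_line:
  assumes "(f has_derivative f') (at x)"
  shows "((\<lambda>t. f (x + t *\<^sub>R v)) has_real_derivative f' v) (at 0)"
proof -
  have "((\<lambda>t. x + t *\<^sub>R v) has_derivative (\<lambda>t. t *\<^sub>R v)) (at (0::real))"
    by (auto intro!: derivative_eq_intros)
  moreover have "(f has_derivative f') (at (x + 0 *\<^sub>R v))"
    using assms by simp
  ultimately have "((\<lambda>t. f (x + t *\<^sub>R v)) has_derivative (\<lambda>t. f' (t *\<^sub>R v))) (at 0)"
    by (rule has_derivative_compose)
  moreover have "f' (t *\<^sub>R v) = f' v * t" for t
    using has_derivative_linear[OF assms] by (simp add: linear_cmul)
  ultimately show ?thesis
    by (simp add: has_field_derivative_def)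
qed

section \<open>Test functions, weak gradients and the divergence of radial fields\<close>

lemma test_function_grad:
  assumes "\<phi> \<in> test_functions \<Omega>"
  shows "(\<phi> has_derivative (\<lambda>v. grad \<phi> x \<bullet> v)) (at x)"
    and "continuous_on UNIV (grad \<phi>)"
proof -
  have C: "Ck (Suc 0) \<phi>"
    using assms by (auto simp: test_functions_def simp del: Ck.simps)
  have lin: "linear (frechet_derivative \<phi> (at x))"
    using C by (simp add: linear_frechet_derivative)
  have "frechet_derivative \<phi> (at x) v = grad \<phi> x \<bullet> v" for v
  proof -
    have "frechet_derivative \<phi> (at x) v = frechet_derivative \<phi> (at x) (\<Sum>i\<in>UNIV. v $ i *\<^sub>R axis i 1)"
      using basis_expansion[of v] by (simp add: scalar_mult_eq_scaleR)
    also have "\<dots> = (\<Sum>i\<in>UNIV. v $ i * frechet_derivative \<phi> (at x) (axis i 1))"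
      by (simp add: linear_sum[OF lin] linear_cmul[OF lin])
    finally show ?thesis
      by (simp add: grad_def inner_vec_def mult.commute)
  qed
  then have "frechet_derivative \<phi> (at x) = (\<lambda>v. grad \<phi> x \<bullet> v)" by auto
  then show "(\<phi> has_derivative (\<lambda>v. grad \<phi> x \<bullet> v)) (at x)"
    using Ck_SucD(1)[OF C, of x] by simp
  have "\<And>v. continuous_on UNIV (\<lambda>x. frechet_derivative \<phi> (at x) v)"
    using C by simp
  then show "continuous_on UNIV (grad \<phi>)"
    unfolding grad_def by (intro continuous_on_vec_lambda)
qed

lemma grad_eq:
  assumes "(f has_derivative (\<lambda>v. G \<bullet> v)) (at x)"
  shows "grad f x = G"
  using frechet_derivative_at[OF assms] by (simp add: grad_def vec_eq_iff inner_axis flip: frechet_derivative_at[OF assms])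

text \<open>The complement of the closed support is open, so the derivative vanishes there as well.
  This permits replacing integrals over \<open>\<Omega>\<close> by integrals over the whole space,
  where translations act.\<close>

lemma test_function_zero:
  assumes "\<phi> \<in> test_functions \<Omega>" "x \<notin> \<Omega>"
  shows "\<phi> x = 0" and "grad \<phi> x = 0"
proof -
  let ?K = "closure {x. \<phi> x \<noteq> 0}"
  have x: "x \<in> - ?K" and z: "\<And>y. y \<in> - ?K \<Longrightarrow> \<phi> y = 0"
    using assms closure_subset[of "{x. \<phi> x \<noteq> 0}"] by (auto simp: test_functions_def)
  show "\<phi> x = 0" using x z by blast
  have d0: "((\<lambda>_. 0) has_derivative (\<lambda>v. 0 \<bullet> v)) (at x)" by simp
  have op: "open (- ?K)" by (intro open_Compl closed_closure)
  have "(\<phi> has_derivative (\<lambda>v. 0 \<bullet> v)) (at x)"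
    by (rule has_derivative_transform_within_open[OF d0 op x]) (rule z[symmetric])
  then show "grad \<phi> x = 0" by (rule grad_eq)
qed

lemma test_function_bounded_support:
  assumes "\<phi> \<in> test_functions \<Omega>"
  obtains R where "\<And>x. R < norm x \<Longrightarrow> \<phi> x = 0" and "\<And>x. R < norm x \<Longrightarrow> grad \<phi> x = 0"
proof -
  let ?K = "closure {x. \<phi> x \<noteq> 0}"
  \<comment> \<open>Regarding \<open>\<phi>\<close> as a test function on its own support makes it
    and its gradient vanish off \<open>?K\<close>, not merely off \<open>\<Omega>\<close>.\<close>
  have K: "compact ?K" and \<phi>: "\<phi> \<in> test_functions ?K"
    using assms by (auto simp: test_functions_def)
  from compact_imp_bounded[OF K] obtain R where "\<And>x. x \<in> ?K \<Longrightarrow> norm x \<le> R"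
    unfolding bounded_iff by blast
  then have "\<And>x. R < norm x \<Longrightarrow> x \<notin> ?K" by fastforce
  then show thesis
    using that test_function_zero[OF \<phi>] by blast
qed

lemma integral_lebesgue_on_eq:
  fixes f :: "'a::euclidean_space \<Rightarrow> 'b::euclidean_space"
  assumes "\<Omega> \<in> sets lebesgue" "\<And>x. x \<notin> \<Omega> \<Longrightarrow> f x = 0"
  shows "integral\<^sup>L (lebesgue_on \<Omega>) f = integral\<^sup>L lebesgue f"
    and "integrable (lebesgue_on \<Omega>) f \<longleftrightarrow> integrable lebesgue f"
proof -
  have "(\<lambda>x. indicator \<Omega> x *\<^sub>R f x) = f"
    using assms(2) by (auto simp: indicator_def)
  then show "integral\<^sup>L (lebesgue_on \<Omega>) f = integral\<^sup>L lebesgue f"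
    and "integrable (lebesgue_on \<Omega>) f \<longleftrightarrow> integrable lebesgue f"
    using assms(1) by (simp_all add: integral_restrict_space integrable_restrict_space)
qed

lemma locally_integrable_continuous:
  fixes f :: "'a::euclidean_space \<Rightarrow> 'b::euclidean_space"
  assumes "continuous_on UNIV f"
  shows "locally_integrable \<Omega> f"
  unfolding locally_integrable_def
proof (intro allI impI)
  fix K assume "compact K \<and> K \<subseteq> \<Omega>"
  then have K: "compact K" by simp
  have "integrable lborel (\<lambda>x. indicator K x *\<^sub>R f x)"
    by (rule borel_integrable_compact) (use K in \<open>auto intro: continuous_on_subset[OF assms]\<close>)
  moreover have "(\<lambda>x. indicator K x *\<^sub>R f x) \<in> borel_measurable borel"
    using borel_measurable_integrable[OF calculation] by simp
  ultimately have "integrable lebesgue (\<lambda>x. indicator K x *\<^sub>R f x)"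
    by (subst integrable_completion) auto
  then show "integrable (lebesgue_on K) f"
    using K by (subst integrable_restrict_space) (auto intro: lmeasurable_compact[THEN fmeasurableD])
qed

text \<open>The product \<open>u \<phi>\<close> is Lipschitz on balls and compactly supported, so
  each of its partial derivatives has integral 0; the product rule then gives the identity
  coordinate by coordinate.\<close>

lemma weak_gradient_C1:
  fixes u :: "real ^ 'n \<Rightarrow> real"
  assumes u: "\<And>x. (u has_derivative (\<lambda>v. G x \<bullet> v)) (at x)" and G: "continuous_on UNIV G"
    and \<Omega>: "\<Omega> \<in> sets lebesgue"
  shows "weak_gradient \<Omega> u G"
  unfolding weak_gradient_def
proof (intro conjI ballI)
  have cu: "continuous_on UNIV u"
    using u by (meson continuous_at_imp_continuous_on has_derivative_continuous)
  then show "locally_integrable \<Omega> u" "locally_integrable \<Omega> G"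
    using G by (auto intro: locally_integrable_continuous)
  fix \<phi> assume \<phi>: "\<phi> \<in> test_functions \<Omega>"
  note d\<phi> = test_function_grad[OF \<phi>]
  have c\<phi>: "continuous_on UNIV \<phi>"
    using d\<phi>(1) by (meson continuous_at_imp_continuous_on has_derivative_continuous)
  obtain R where R: "\<And>x. R < norm x \<Longrightarrow> \<phi> x = 0" "\<And>x. R < norm x \<Longrightarrow> grad \<phi> x = 0"
    using test_function_bounded_support[OF \<phi>] by blast
  have i1: "integrable lebesgue (\<lambda>x. u x *\<^sub>R grad \<phi> x)"
    by (rule integrable_lebesgue_compact_support[where R=R])
      (auto intro!: continuous_intros cu d\<phi>(2) simp: R)
  have i2: "integrable lebesgue (\<lambda>x. \<phi> x *\<^sub>R G x)"
    by (rule integrable_lebesgue_compact_support[where R=R])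
      (auto intro!: continuous_intros c\<phi> G simp: R)
  have "integral\<^sup>L lebesgue (\<lambda>x. u x *\<^sub>R grad \<phi> x + \<phi> x *\<^sub>R G x) $ i = 0" for i
  proof -
    have "integral\<^sup>L lebesgue (\<lambda>x. u x *\<^sub>R grad \<phi> x + \<phi> x *\<^sub>R G x) $ i
        = integral\<^sup>L lebesgue (\<lambda>x. (u x *\<^sub>R grad \<phi> x + \<phi> x *\<^sub>R G x) $ i)"
      using integral_bounded_linear[OF bounded_linear_vec_nth[of i] Bochner_Integration.integrable_add[OF i1 i2]]
      by simp
    also have "\<dots> = 0"
    proof (rule integral_directional_derivative_eq_0(2)[where w="\<lambda>x. u x * \<phi> x" and v="axis i 1" and R=R])
      show "lipschitz_on_balls (\<lambda>x. u x * \<phi> x)"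
        by (intro lipschitz_on_balls_mult lipschitz_on_balls_C1[OF u G] lipschitz_on_balls_C1[OF d\<phi>])
      show "(\<lambda>x. (u x *\<^sub>R grad \<phi> x + \<phi> x *\<^sub>R G x) $ i) \<in> borel_measurable lebesgue"
        using integrable_bounded_linear[OF bounded_linear_vec_nth[of i] Bochner_Integration.integrable_add[OF i1 i2]]
        by simp
      show "AE x in lebesgue. ((\<lambda>t. u (x + t *\<^sub>R axis i 1) * \<phi> (x + t *\<^sub>R axis i 1))
          has_real_derivative (u x *\<^sub>R grad \<phi> x + \<phi> x *\<^sub>R G x) $ i) (at 0)"
        by (rule AE_I2, rule has_real_derivative_along_line
            [OF has_derivative_mult[OF u d\<phi>(1)], where v="axis i 1", THEN DERIV_cong])
          (simp add: inner_axis mult.commute)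
    qed (simp add: R)
    finally show ?thesis .
  qed
  then have "integral\<^sup>L lebesgue (\<lambda>x. u x *\<^sub>R grad \<phi> x + \<phi> x *\<^sub>R G x) = 0"
    by (simp add: vec_eq_iff)
  then have "integral\<^sup>L lebesgue (\<lambda>x. u x *\<^sub>R grad \<phi> x) = - integral\<^sup>L lebesgue (\<lambda>x. \<phi> x *\<^sub>R G x)"
    using i1 i2 by (simp add: eq_neg_iff_add_eq_0)
  then show "integral\<^sup>L (lebesgue_on \<Omega>) (\<lambda>x. u x *\<^sub>R grad \<phi> x) =
      - integral\<^sup>L (lebesgue_on \<Omega>) (\<lambda>x. \<phi> x *\<^sub>R G x)"
    by (simp add: integral_lebesgue_on_eq[OF \<Omega>] test_function_zero[OF \<phi>])
qed

text \<open>The field \<open>h(|x|) x\<close> has divergence \<open>n h + r h'\<close>. Applying the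
  vanishing integral to each \<open>h(|x|) x_i \<phi>\<close> and summing over \<open>i\<close>
  gives the identity. The finite set \<open>N\<close> admits profiles with corners, since spheres
  are null sets.\<close>

lemma radial_field_weak_divergence:
  fixes \<phi> :: "real ^ 'n \<Rightarrow> real"
  assumes \<phi>: "\<phi> \<in> test_functions \<Omega>"
    and lip: "lipschitz_on_balls h"
    and N: "finite N" and h: "\<And>r. 0 < r \<Longrightarrow> r \<notin> N \<Longrightarrow> (h has_real_derivative h' r) (at r)"
    and h': "h' \<in> borel_measurable borel"
  shows "integrable lebesgue (\<lambda>x. h (norm x) * (x \<bullet> grad \<phi> x))"
    and "integrable lebesgue (\<lambda>x. (real CARD('n) * h (norm x) + norm x * h' (norm x)) * \<phi> x)"
    and "integral\<^sup>L lebesgue (\<lambda>x. h (norm x) * (x \<bullet> grad \<phi> x))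
      = - integral\<^sup>L lebesgue (\<lambda>x. (real CARD('n) * h (norm x) + norm x * h' (norm x)) * \<phi> x)"
proof -
  note d\<phi> = test_function_grad[OF \<phi>]
  have c\<phi>: "continuous_on UNIV \<phi>"
    using d\<phi>(1) by (meson continuous_at_imp_continuous_on has_derivative_continuous)
  obtain R where R: "\<And>x. R < norm x \<Longrightarrow> \<phi> x = 0" "\<And>x. R < norm x \<Longrightarrow> grad \<phi> x = 0"
    using test_function_bounded_support[OF \<phi>] by blast
  have lh: "lipschitz_on_balls (\<lambda>x::real^'n. h (norm x))"
    unfolding lipschitz_on_balls_def
  proof
    fix b
    obtain L where L: "L-lipschitz_on (cball 0 b) h"
      using lip unfolding lipschitz_on_balls_def by blast
    have "L-lipschitz_on (cball (0::real^'n) b) (\<lambda>x. h (norm x))"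
    proof (rule lipschitz_onI)
      fix x y :: "real^'n" assume "x \<in> cball 0 b" "y \<in> cball 0 b"
      then have "dist (h (norm x)) (h (norm y)) \<le> L * dist (norm x) (norm y)"
        by (intro lipschitz_onD[OF L]) auto
      also have "\<dots> \<le> L * dist x y"
        using lipschitz_on_nonneg[OF L]
        by (intro mult_left_mono) (auto simp: dist_norm norm_triangle_ineq3)
      finally show "dist (h (norm x)) (h (norm y)) \<le> L * dist x y" .
    qed (rule lipschitz_on_nonneg[OF L])
    then show "\<exists>L. L-lipschitz_on (cball (0::real^'n) b) (\<lambda>x. h (norm x))" by blast
  qed
  note ch = lipschitz_on_balls_imp_continuous[OF lh]
  have lx: "lipschitz_on_balls (\<lambda>x::real^'n. x $ i)" for i
    by (rule lipschitz_on_balls_C1[where G="\<lambda>_. axis i 1"])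
      (auto simp: inner_axis' intro!: bounded_linear_imp_has_derivative bounded_linear_vec_nth)
  have mh': "(\<lambda>x::real^'n. h' (norm x)) \<in> borel_measurable borel"
    using h' by measurable
  have m\<phi>: "\<phi> \<in> borel_measurable borel" "(\<lambda>x. grad \<phi> x $ i) \<in> borel_measurable borel"
    "(\<lambda>x::real^'n. x $ i) \<in> borel_measurable borel"
    and mh: "(\<lambda>x::real^'n. h (norm x)) \<in> borel_measurable borel" for i
    by (auto intro!: borel_measurable_continuous_onI continuous_intros c\<phi> d\<phi>(2) ch)
  \<comment> \<open>The derivative of \<open>h(|x|) x_i \<phi>\<close> in the direction
    \<open>axis i 1\<close>, wherever it exists.\<close>
  define D where "D i x = h (norm x) * \<phi> x + h' (norm x) * (x $ i)\<^sup>2 / norm x * \<phi> x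
      + h (norm x) * (x $ i * grad \<phi> x $ i)" for i x
  have D: "integrable lebesgue (D i)" "integral\<^sup>L lebesgue (D i) = 0" for i
  proof -
    \<comment> \<open>The norm is not differentiable at the origin, and \<open>h\<close> possibly
      not on the spheres with radius in \<open>N\<close>.\<close>
    let ?S = "insert 0 (\<Union>r\<in>N. sphere 0 r) :: (real^'n) set"
    have S: "negligible ?S"
      using N by (auto intro!: negligible_Union simp: negligible_convex_frontier frontier_cball[symmetric] simp del: frontier_cball)
    have 1: "lipschitz_on_balls (\<lambda>x. h (norm x) * (x $ i * \<phi> x))"
      by (intro lipschitz_on_balls_mult lh lx lipschitz_on_balls_C1[OF d\<phi>])
    have 2: "D i \<in> borel_measurable lebesgue"
    proof -
      have "D i \<in> borel_measurable borel"
        unfolding D_def[abs_def] using m\<phi> mh mh' by measurable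
      then show ?thesis by (simp add: measurable_completion)
    qed
    have 3: "AE x in lebesgue. ((\<lambda>t. h (norm (x + t *\<^sub>R axis i 1)) * ((x + t *\<^sub>R axis i 1) $ i * \<phi> (x + t *\<^sub>R axis i 1)))
        has_real_derivative D i x) (at 0)"
    proof (rule AE_I')
      show "?S \<in> null_sets lebesgue" using S by (simp add: negligible_iff_null_sets)
      have "((\<lambda>t. h (norm (x + t *\<^sub>R axis i 1)) * ((x + t *\<^sub>R axis i 1) $ i * \<phi> (x + t *\<^sub>R axis i 1)))
        has_real_derivative D i x) (at 0)" if "x \<notin> ?S" for x
      proof -
        have x0: "x \<noteq> 0" "norm x \<notin> N" using that by auto
        have "((\<lambda>x. h (norm x)) has_derivative (\<lambda>v. h' (norm x) * (x \<bullet> v / norm x))) (at x)"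
        proof -
          have "(norm has_derivative (\<lambda>v. x \<bullet> v / norm x)) (at x)"
            using has_derivative_norm[OF x0(1)] by (simp add: sgn_div_norm inner_commute divide_inverse mult.commute)
          moreover have "(h has_derivative (*) (h' (norm x))) (at (norm x))"
            using h[of "norm x"] x0 by (simp add: has_field_derivative_def)
          ultimately show ?thesis by (rule has_derivative_compose)
        qed
        moreover have "((\<lambda>x. x $ i) has_derivative (\<lambda>v. v $ i)) (at x)"
          by (intro bounded_linear_imp_has_derivative bounded_linear_vec_nth)
        ultimately have "((\<lambda>x. h (norm x) * (x $ i * \<phi> x)) has_derivative
          (\<lambda>v. h (norm x) * (x $ i * (grad \<phi> x \<bullet> v) + v $ i * \<phi> x) + h' (norm x) * (x \<bullet> v / norm x) * (x $ i * \<phi> x))) (at x)"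
          by (intro has_derivative_mult d\<phi>(1))
        from has_real_derivative_along_line[OF this, of "axis i 1"] show ?thesis
          by (rule DERIV_cong) (simp add: D_def inner_axis power2_eq_square algebra_simps)
      qed
      then show "{x \<in> space lebesgue. \<not> ((\<lambda>t. h (norm (x + t *\<^sub>R axis i 1)) * ((x + t *\<^sub>R axis i 1) $ i * \<phi> (x + t *\<^sub>R axis i 1)))
        has_real_derivative D i x) (at 0)} \<subseteq> ?S" by blast
    qed
    have 4: "h (norm x) * (x $ i * \<phi> x) = 0" if "R < norm x" for x
      using R(1)[OF that] by simp
    show "integrable lebesgue (D i)" "integral\<^sup>L lebesgue (D i) = 0"
      using integral_directional_derivative_eq_0[OF 1 4 2 3] by blast+
  qed
  let ?A = "\<lambda>x. h (norm x) * (x \<bullet> grad \<phi> x)"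
  let ?B = "\<lambda>x. (real CARD('n) * h (norm x) + norm x * h' (norm x)) * \<phi> x"
  show A: "integrable lebesgue ?A"
    by (rule integrable_lebesgue_compact_support[where R=R])
      (auto intro!: continuous_intros ch d\<phi>(2) simp: R)
  \<comment> \<open>True at the origin too: there division by \<open>norm x = 0\<close> returns 0,
    and so does the factor \<open>norm x\<close> on the right.\<close>
  have sum: "(\<Sum>i\<in>UNIV. D i x) = ?A x + ?B x" for x
  proof -
    have "(\<Sum>i\<in>UNIV. (x $ i)\<^sup>2) = (norm x)\<^sup>2"
      unfolding power2_norm_eq_inner inner_vec_def by (simp add: power2_eq_square)
    moreover have "(\<Sum>i\<in>UNIV. h' (norm x) * (x $ i)\<^sup>2 / norm x * \<phi> x)
        = h' (norm x) * (\<Sum>i\<in>UNIV. (x $ i)\<^sup>2) / norm x * \<phi> x"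
      by (simp add: sum_distrib_left sum_distrib_right sum_divide_distrib)
    ultimately have "(\<Sum>i\<in>UNIV. h' (norm x) * (x $ i)\<^sup>2 / norm x * \<phi> x) = norm x * h' (norm x) * \<phi> x"
      by (simp add: power2_eq_square)
    moreover have "(\<Sum>i\<in>UNIV. h (norm x) * (x $ i * grad \<phi> x $ i)) = ?A x"
      by (simp add: sum_distrib_left inner_vec_def)
    ultimately show ?thesis
      by (simp add: D_def sum.distrib algebra_simps)
  qed
  have sumi: "integrable lebesgue (\<lambda>x. \<Sum>i\<in>UNIV. D i x)"
    by (intro Bochner_Integration.integrable_sum D)
  show B: "integrable lebesgue ?B"
    using Bochner_Integration.integrable_diff[OF sumi A] by (simp add: sum)
  have "integral\<^sup>L lebesgue (\<lambda>x. \<Sum>i\<in>UNIV. D i x) = 0"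
    by (subst Bochner_Integration.integral_sum) (auto simp: D)
  then show "integral\<^sup>L lebesgue ?A = - integral\<^sup>L lebesgue ?B"
    unfolding sum using A B by simp
qed

section \<open>Radial functions in \<open>W\<^sub>0\<^sup>1\<^sup>,\<^sup>p\<close>\<close>

text \<open>Dominated convergence. Only pointwise convergence is asked for, because the gradients of
  the cutoff approximants need not converge uniformly up to the unit sphere.\<close>

lemma Lp_norm_tendsto_0:
  fixes f :: "nat \<Rightarrow> 'a::euclidean_space \<Rightarrow> 'b::euclidean_space"
  assumes \<Omega>: "\<Omega> \<in> lmeasurable" and p: "0 < p"
    and meas: "\<And>k. f k \<in> borel_measurable (lebesgue_on \<Omega>)"
    and bound: "\<And>k x. x \<in> \<Omega> \<Longrightarrow> norm (f k x) \<le> C"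
    and lim: "\<And>x. x \<in> \<Omega> \<Longrightarrow> (\<lambda>k. f k x) \<longlonglongrightarrow> 0"
  shows "(\<lambda>k. Lp_norm p \<Omega> (f k)) \<longlonglongrightarrow> 0"
proof -
  have sp: "space (lebesgue_on \<Omega>) = \<Omega>" by simp
  interpret finite_measure "lebesgue_on \<Omega>"
    by (rule finite_measure_lebesgue_on[OF \<Omega>])
  have "(\<lambda>k. integral\<^sup>L (lebesgue_on \<Omega>) (\<lambda>x. norm (f k x) powr p)) \<longlonglongrightarrow>
      integral\<^sup>L (lebesgue_on \<Omega>) (\<lambda>x. 0)"
  proof (rule integral_dominated_convergence[where w="\<lambda>_. C powr p"])
    show "AE x in lebesgue_on \<Omega>. (\<lambda>k. norm (f k x) powr p) \<longlonglongrightarrow> 0"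
    proof (rule AE_I2)
      fix x assume "x \<in> space (lebesgue_on \<Omega>)"
      then have "(\<lambda>k. norm (f k x)) \<longlonglongrightarrow> 0"
        using lim by (simp add: tendsto_norm_zero)
      then show "(\<lambda>k. norm (f k x) powr p) \<longlonglongrightarrow> 0"
        by (rule tendsto_zero_powrI[OF _ tendsto_const]) (use p in auto)
    qed
    show "AE x in lebesgue_on \<Omega>. norm (norm (f k x) powr p) \<le> C powr p" for k
      using bound p by (intro AE_I2) (auto intro!: powr_mono2)
    show "(\<lambda>x. norm (f k x) powr p) \<in> borel_measurable (lebesgue_on \<Omega>)" for k
      using meas[of k] by measurable
  qed auto
  then have "(\<lambda>k. integral\<^sup>L (lebesgue_on \<Omega>) (\<lambda>x. norm (f k x) powr p)) \<longlonglongrightarrow> 0" by simp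
  then show ?thesis
    unfolding Lp_norm_def
    by (rule tendsto_zero_powrI[OF _ tendsto_const]) (use p in auto)
qed

lemma in_Lp_bounded:
  fixes f :: "'a::euclidean_space \<Rightarrow> 'b::euclidean_space"
  assumes \<Omega>: "\<Omega> \<in> lmeasurable" and p: "0 \<le> p"
    and meas: "f \<in> borel_measurable (lebesgue_on \<Omega>)"
    and bound: "\<And>x. x \<in> \<Omega> \<Longrightarrow> norm (f x) \<le> C"
  shows "in_Lp p \<Omega> f"
proof -
  interpret finite_measure "lebesgue_on \<Omega>"
    by (rule finite_measure_lebesgue_on[OF \<Omega>])
  have "integrable (lebesgue_on \<Omega>) (\<lambda>x. norm (f x) powr p)"
  proof (rule integrable_const_bound[where B="C powr p"])
    show "AE x in lebesgue_on \<Omega>. norm (norm (f x) powr p) \<le> C powr p"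
      using bound p by (intro AE_I2) (auto intro!: powr_mono2)
    show "(\<lambda>x. norm (f x) powr p) \<in> borel_measurable (lebesgue_on \<Omega>)"
      using meas by measurable
  qed
  with meas show ?thesis by (simp add: in_Lp_def)
qed

lemma borel_measurable_lebesgue_on_continuous:
  fixes f :: "'a::euclidean_space \<Rightarrow> 'b::euclidean_space"
  assumes "continuous_on UNIV f"
  shows "f \<in> borel_measurable (lebesgue_on \<Omega>)"
  by (intro measurable_restrict_space1 measurable_completion)
    (simp add: borel_measurable_continuous_onI[OF assms])

text \<open>The approximant is the antiderivative of a polynomial approximation of \<open>-g\<close> multiplied by
  a flat cutoff at \<open>1 - \<delta>\<close>; the width \<open>\<delta>\<^sup>2\<close> of the cutoff makes it \<open>\<ge> 1 - \<delta>\<close> below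
  \<open>1 - 2\<delta>\<close>.\<close>

lemma smooth_cutoff_approximation:
  fixes F g :: "real \<Rightarrow> real"
  assumes F: "\<And>s. (F has_real_derivative - g s) (at s)" and g: "continuous_on UNIV g"
    and F1: "F 1 = 0"
  obtains M where "\<And>\<delta>. 0 < \<delta> \<Longrightarrow> \<delta> < 1/2 \<Longrightarrow>
    \<exists>\<Phi> \<gamma>. (\<forall>k. Ck k \<Phi>) \<and> (\<forall>s. (\<Phi> has_real_derivative - \<gamma> s) (at s)) \<and> continuous_on UNIV \<gamma> \<and>
      (\<forall>s\<ge>1 - \<delta>. \<Phi> s = 0) \<and> (\<forall>s\<in>{0..1}. \<bar>\<gamma> s\<bar> \<le> M) \<and>
      (\<forall>s\<in>{0..1 - 2 * \<delta>}. \<bar>\<gamma> s - g s\<bar> \<le> M * \<delta>) \<and> (\<forall>s\<in>{0..1}. \<bar>\<Phi> s - F s\<bar> \<le> M * \<delta>)"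
proof -
  have "bounded (g ` {0..1})"
    by (intro compact_imp_bounded compact_continuous_image continuous_on_subset[OF g]) auto
  then obtain A where A: "\<And>s. s \<in> {0..1} \<Longrightarrow> \<bar>g s\<bar> \<le> A" and A0: "A > 0"
    unfolding bounded_pos real_norm_def by (meson image_eqI)
  \<comment> \<open>The constant is the sum \<open>(4 * A + 2) + (A + 1)\<close> of the errors of
    the boundary layer and of the interior, where \<open>A\<close> bounds \<open>g\<close> on the
    unit interval.\<close>
  have main: "\<exists>\<Phi> \<gamma>. (\<forall>k. Ck k \<Phi>) \<and> (\<forall>s. (\<Phi> has_real_derivative - \<gamma> s) (at s)) \<and> continuous_on UNIV \<gamma> \<and>
      (\<forall>s\<ge>1 - \<delta>. \<Phi> s = 0) \<and> (\<forall>s\<in>{0..1}. \<bar>\<gamma> s\<bar> \<le> 5 * A + 3) \<and>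
      (\<forall>s\<in>{0..1 - 2 * \<delta>}. \<bar>\<gamma> s - g s\<bar> \<le> (5 * A + 3) * \<delta>) \<and> (\<forall>s\<in>{0..1}. \<bar>\<Phi> s - F s\<bar> \<le> (5 * A + 3) * \<delta>)"
    if \<delta>: "0 < \<delta>" "\<delta> < 1/2" for \<delta>
  proof -
    \<comment> \<open>A polynomial replaces \<open>g\<close> because \<open>g\<close> is merely
      continuous, while the antiderivative must have derivatives of every order.\<close>
    obtain P where P: "real_polynomial_function P" "\<And>s. s \<in> {0..1} \<Longrightarrow> \<bar>g s - P s\<bar> < \<delta>"
      using Stone_Weierstrass_real_polynomial_function[of "{0..1}" g \<delta>] \<delta> continuous_on_subset[OF g]
      by (metis compact_Icc subset_UNIV)
    define \<eta> where "\<eta> s = flat_exp 0 ((1 - \<delta>) / \<delta>\<^sup>2 + (- 1 / \<delta>\<^sup>2) * s)" for s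
    define \<gamma> where "\<gamma> s = P s * \<eta> s" for s
    have \<eta>01: "0 \<le> \<eta> s" "\<eta> s \<le> 1" for s
      by (simp_all add: \<eta>_def flat_exp_0_bounds)
    have arg: "(1 - \<delta>) / \<delta>\<^sup>2 + (- 1 / \<delta>\<^sup>2) * s = (1 - \<delta> - s) / \<delta>\<^sup>2" for s
      by (simp add: diff_divide_distrib)
    have \<eta>0: "\<eta> s = 0" if "1 - \<delta> \<le> s" for s
      using that \<delta> unfolding \<eta>_def arg by (simp add: flat_exp_def zero_less_divide_iff)
    have \<eta>1: "1 - \<delta> \<le> \<eta> s" if "s \<le> 1 - 2 * \<delta>" for s
    proof -
      have "1 / \<delta> \<le> (1 - \<delta> - s) / \<delta>\<^sup>2"
        using that \<delta> by (simp add: field_simps power2_eq_square)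
      moreover from this have pos: "0 < (1 - \<delta> - s) / \<delta>\<^sup>2"
        using \<delta> by (smt (verit) divide_pos_pos)
      ultimately have "1 / ((1 - \<delta> - s) / \<delta>\<^sup>2) \<le> \<delta>"
        using \<delta> by (metis divide_inverse inverse_inverse_eq inverse_positive_iff_positive le_imp_inverse_le mult_1)
      then show ?thesis
        using flat_exp_0_ge[OF pos] unfolding \<eta>_def arg by linarith
    qed
    have C\<gamma>: "Ck k \<gamma>" for k
      unfolding \<gamma>_def[abs_def] \<eta>_def
      by (intro Ck_mult Ck_polynomial P(1) Ck_compose[OF Ck_flat_exp] Ck_add Ck_const
          Ck_bounded_linear bounded_linear_mult_right)
    have c\<gamma>: "continuous_on UNIV \<gamma>"
      using C\<gamma> Ck_imp_continuous by blast
    have "\<exists>H. \<forall>x::real. - \<infinity> < ereal x \<longrightarrow> ereal x < \<infinity> \<longrightarrow> (H has_vector_derivative - \<gamma> x) (at x)"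
      by (rule einterval_antiderivative)
        (use c\<gamma> in \<open>auto simp: continuous_on_eq_continuous_at intro!: continuous_minus\<close>)
    then obtain H where H: "\<And>x. (H has_real_derivative - \<gamma> x) (at x)"
      by (auto simp: has_real_derivative_iff_has_vector_derivative)
    define \<Phi> where "\<Phi> s = H s - H 1" for s
    have \<Phi>: "(\<Phi> has_real_derivative - \<gamma> s) (at s)" for s
      unfolding \<Phi>_def[abs_def] using DERIV_diff[OF H DERIV_const] by simp
    have C\<Phi>: "Ck k \<Phi>" for k
    proof (rule Ck_real_antiderivative[OF \<Phi>])
      show "Ck j (\<lambda>s. - \<gamma> s)" for j
        using Ck_mult[OF Ck_const[of j "-1"] C\<gamma>[of j]] by simp
    qed
    \<comment> \<open>The antiderivative is normalised at 1, and its derivative vanishes beyond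
      \<open>1 - \<delta>\<close>.\<close>
    have \<Phi>0: "\<Phi> s = 0" if "1 - \<delta> \<le> s" for s
    proof -
      have "norm (\<Phi> s - \<Phi> 1) \<le> 0 * norm (s - 1)"
      proof (rule field_differentiable_bound[where S="{1 - \<delta>..}"])
        show "(\<Phi> has_field_derivative - \<gamma> z) (at z within {1 - \<delta>..})" for z
          using \<Phi> has_field_derivative_at_within by blast
      qed (use that \<delta> \<eta>0 in \<open>auto simp: \<gamma>_def\<close>)
      then show ?thesis by (simp add: \<Phi>_def)
    qed
    have P_bound: "\<bar>P s\<bar> \<le> A + 1/2" if "s \<in> {0..1}" for s
      using P(2)[OF that] A[OF that] \<delta> by linarith
    have \<gamma>_bound: "\<bar>\<gamma> s\<bar> \<le> A + 1/2" if "s \<in> {0..1}" for s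
      using P_bound[OF that] \<eta>01[of s] unfolding \<gamma>_def abs_mult
      by (smt (verit) mult_left_le abs_ge_zero)
    have d_bound: "\<bar>\<gamma> s - g s\<bar> \<le> 2 * A + 1" if "s \<in> {0..1}" for s
      using \<gamma>_bound[OF that] A[OF that] by linarith
    have d_small: "\<bar>\<gamma> s - g s\<bar> \<le> (A + 1) * \<delta>" if s: "s \<in> {0..1 - 2 * \<delta>}" for s
    proof -
      have s1: "s \<in> {0..1}" using s \<delta> by auto
      have "\<gamma> s - g s = (P s - g s) * \<eta> s - g s * (1 - \<eta> s)"
        by (simp add: \<gamma>_def algebra_simps)
      then have "\<bar>\<gamma> s - g s\<bar> \<le> \<bar>P s - g s\<bar> * \<bar>\<eta> s\<bar> + \<bar>g s\<bar> * \<bar>1 - \<eta> s\<bar>"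
        by (metis abs_mult abs_triangle_ineq4)
      also have "\<dots> \<le> \<delta> * 1 + A * \<delta>"
        using P(2)[OF s1] A[OF s1] \<eta>01[of s] \<eta>1[of s] s \<delta> A0
        by (intro add_mono mult_mono) auto
      finally show ?thesis by (simp add: algebra_simps)
    qed
    have E: "((\<lambda>s. \<Phi> s - F s) has_real_derivative - (\<gamma> z - g z)) (at z within S)" for z S
      using has_field_derivative_at_within[OF DERIV_diff[OF \<Phi> F]]
      by (rule DERIV_cong) simp
    \<comment> \<open>The error is integrated from \<open>s = 1\<close>, where both functions
      vanish. In the layer of width \<open>2 * \<delta>\<close> the crude bound on
      \<open>\<gamma> - g\<close> is enough; below it the bound of order \<open>\<delta>\<close>
      takes over.\<close>
    have near: "\<bar>\<Phi> s - F s\<bar> \<le> (4 * A + 2) * \<delta>" if s: "s \<in> {1 - 2 * \<delta>..1}" for s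
    proof -
      have "norm ((\<Phi> s - F s) - (\<Phi> 1 - F 1)) \<le> (2 * A + 1) * norm (s - 1)"
      proof (rule field_differentiable_bound[OF _ E])
        show "norm (- (\<gamma> z - g z)) \<le> 2 * A + 1" if "z \<in> {0..1}" for z
          using d_bound[OF that] by (simp add: abs_minus_commute)
      qed (use s \<delta> in auto)
      also have "\<dots> \<le> (2 * A + 1) * (2 * \<delta>)"
        using s A0 by (intro mult_left_mono) auto
      finally show ?thesis by (simp add: \<Phi>_def F1 algebra_simps)
    qed
    have "\<bar>\<Phi> s - F s\<bar> \<le> (5 * A + 3) * \<delta>" if s: "s \<in> {0..1}" for s
    proof (cases "s \<le> 1 - 2 * \<delta>")
      case False
      then have "\<bar>\<Phi> s - F s\<bar> \<le> (4 * A + 2) * \<delta>" using near s by auto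
      also have "\<dots> \<le> (5 * A + 3) * \<delta>" using A0 \<delta> by (intro mult_right_mono) auto
      finally show ?thesis .
    next
      case True
      let ?t = "1 - 2 * \<delta>"
      have "norm ((\<Phi> s - F s) - (\<Phi> ?t - F ?t)) \<le> ((A + 1) * \<delta>) * norm (s - ?t)"
      proof (rule field_differentiable_bound[OF _ E])
        show "norm (- (\<gamma> z - g z)) \<le> (A + 1) * \<delta>" if "z \<in> {0..?t}" for z
          using d_small[OF that] by (simp add: abs_minus_commute)
      qed (use s True \<delta> in auto)
      also have "\<dots> \<le> ((A + 1) * \<delta>) * 1"
        using s True \<delta> A0 by (intro mult_left_mono) auto
      finally have "\<bar>(\<Phi> s - F s) - (\<Phi> ?t - F ?t)\<bar> \<le> (A + 1) * \<delta>" by simp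
      moreover have "\<bar>\<Phi> ?t - F ?t\<bar> \<le> (4 * A + 2) * \<delta>" using \<delta> by (intro near) auto
      ultimately show ?thesis by (simp add: algebra_simps)
    qed
    moreover have "\<bar>\<gamma> s\<bar> \<le> 5 * A + 3" if "s \<in> {0..1}" for s
      using \<gamma>_bound[OF that] A0 by linarith
    moreover have "\<bar>\<gamma> s - g s\<bar> \<le> (5 * A + 3) * \<delta>" if "s \<in> {0..1 - 2 * \<delta>}" for s
      by (rule order_trans[OF d_small[OF that]]) (use A0 \<delta> in \<open>auto intro: mult_right_mono\<close>)
    ultimately show ?thesis
      using C\<Phi> \<Phi> \<Phi>0 c\<gamma> by (intro exI[of _ \<Phi>] exI[of _ \<gamma>]) blast
  qed
  show thesis
    by (rule that) (rule main)
qed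

text \<open>Profiles are written in the squared norm, which is smooth even at the origin. The sign
  in the hypothesis suits decreasing profiles.\<close>

lemma has_derivative_radial:
  fixes x :: "'a::euclidean_space"
  assumes "(F has_real_derivative - c) (at ((norm x)\<^sup>2))"
  shows "((\<lambda>x. F ((norm x)\<^sup>2)) has_derivative (\<lambda>v. ((- 2 * c) *\<^sub>R x) \<bullet> v)) (at x)"
proof -
  have "((\<lambda>x. x \<bullet> x) has_derivative (\<lambda>v. 2 * (x \<bullet> v))) (at x)"
    by (auto intro!: derivative_eq_intros simp: inner_commute)
  then have "((\<lambda>x. (norm x)\<^sup>2) has_derivative (\<lambda>v. 2 * (x \<bullet> v))) (at x)"
    by (simp add: power2_norm_eq_inner)
  from has_derivative_compose[OF this assms[unfolded has_field_derivative_def]] show ?thesis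
    by (simp add: mult_ac)
qed

lemma Ck_norm_squared: "Ck k (\<lambda>x::'a::euclidean_space. (norm x)\<^sup>2)"
proof -
  have "Ck (Suc k) (\<lambda>x::'a. x \<bullet> x)"
  proof (rule Ck_SucI)
    fix x v :: 'a
    show "((\<lambda>x. x \<bullet> x) has_derivative (\<lambda>v. 2 * (x \<bullet> v))) (at x)"
      by (auto intro!: derivative_eq_intros simp: inner_commute)
    show "Ck k (\<lambda>x. 2 * (x \<bullet> v))"
      by (intro Ck_mult Ck_const Ck_bounded_linear bounded_linear_inner_left)
  qed
  then show ?thesis
    by (simp only: power2_norm_eq_inner Ck_Suc_imp_Ck)
qed

text \<open>The profile is approximated in one variable and composed with the squared norm. The
  condition \<open>F 1 = 0\<close> expresses the zero boundary values and lets the approximants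
  vanish near the sphere.\<close>

lemma radial_in_W0_1p:
  fixes F g :: "real \<Rightarrow> real"
  assumes F: "\<And>s. (F has_real_derivative - g s) (at s)" and g: "continuous_on UNIV g"
    and F1: "F 1 = 0" and p: "0 < p"
  shows "(\<lambda>x::real^'n. F ((norm x)\<^sup>2)) \<in> W0_1p p (ball 0 1)"
proof -
  define u where "u x = F ((norm x)\<^sup>2)" for x :: "real^'n"
  define G where "G x = (- 2 * g ((norm x)\<^sup>2)) *\<^sub>R x" for x :: "real^'n"
  let ?B = "ball 0 1 :: (real^'n) set"
  have u: "(u has_derivative (\<lambda>v. G x \<bullet> v)) (at x)" for x
    unfolding u_def[abs_def] G_def by (rule has_derivative_radial[OF F])
  have cG: "continuous_on UNIV G"
    unfolding G_def[abs_def] by (auto intro!: continuous_intros continuous_on_compose2[OF g])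
  have cu: "continuous_on UNIV u"
    using u by (meson continuous_at_imp_continuous_on has_derivative_continuous)
  have bdd: "\<exists>C. \<forall>x\<in>?B. norm (f x) \<le> C" if "continuous_on UNIV f" for f :: "real^'n \<Rightarrow> 'b::euclidean_space"
  proof -
    have "bounded (f ` cball 0 1)"
      by (intro compact_imp_bounded compact_continuous_image continuous_on_subset[OF that]) auto
    then show ?thesis unfolding bounded_iff by fastforce
  qed
  have Lp: "in_Lp p ?B f" if "continuous_on UNIV f" for f :: "real^'n \<Rightarrow> 'b::euclidean_space"
    using bdd[OF that] p
    by (auto intro!: in_Lp_bounded borel_measurable_lebesgue_on_continuous that)
  obtain M where M: "\<And>\<delta>. 0 < \<delta> \<Longrightarrow> \<delta> < 1/2 \<Longrightarrow>
    \<exists>\<Phi> \<gamma>. (\<forall>k. Ck k \<Phi>) \<and> (\<forall>s. (\<Phi> has_real_derivative - \<gamma> s) (at s)) \<and> continuous_on UNIV \<gamma> \<and>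
      (\<forall>s\<ge>1 - \<delta>. \<Phi> s = 0) \<and> (\<forall>s\<in>{0..1}. \<bar>\<gamma> s\<bar> \<le> M) \<and>
      (\<forall>s\<in>{0..1 - 2 * \<delta>}. \<bar>\<gamma> s - g s\<bar> \<le> M * \<delta>) \<and> (\<forall>s\<in>{0..1}. \<bar>\<Phi> s - F s\<bar> \<le> M * \<delta>)"
    using smooth_cutoff_approximation[OF F g F1] by blast
  \<comment> \<open>The shift by 3 keeps every term strictly below \<open>1/2\<close>, as the
    approximation requires.\<close>
  define \<delta> where "\<delta> k = inverse (real (k + 3))" for k :: nat
  have \<delta>: "0 < \<delta> k" "\<delta> k < 1/2" for k by (auto simp: \<delta>_def field_simps)
  have \<delta>0: "\<delta> \<longlonglongrightarrow> 0"
    unfolding \<delta>_def using LIMSEQ_ignore_initial_segment[OF lim_inverse_n, of 3] by simp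
  from M[OF \<delta>] have "\<forall>k. \<exists>\<Phi> \<gamma>. (\<forall>j. Ck j \<Phi>) \<and> (\<forall>s. (\<Phi> has_real_derivative - \<gamma> s) (at s)) \<and> continuous_on UNIV \<gamma> \<and>
      (\<forall>s\<ge>1 - \<delta> k. \<Phi> s = 0) \<and> (\<forall>s\<in>{0..1}. \<bar>\<gamma> s\<bar> \<le> M) \<and>
      (\<forall>s\<in>{0..1 - 2 * \<delta> k}. \<bar>\<gamma> s - g s\<bar> \<le> M * \<delta> k) \<and> (\<forall>s\<in>{0..1}. \<bar>\<Phi> s - F s\<bar> \<le> M * \<delta> k)"
    by blast
  then obtain \<Phi> \<gamma> where C\<Phi>: "\<And>k j. Ck j (\<Phi> k)"
    and d\<Phi>: "\<And>k s. (\<Phi> k has_real_derivative - \<gamma> k s) (at s)"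
    and c\<gamma>: "\<And>k. continuous_on UNIV (\<gamma> k)"
    and \<Phi>0: "\<And>k s. 1 - \<delta> k \<le> s \<Longrightarrow> \<Phi> k s = 0"
    and \<gamma>M: "\<And>k s. s \<in> {0..1} \<Longrightarrow> \<bar>\<gamma> k s\<bar> \<le> M"
    and \<gamma>\<delta>: "\<And>k s. s \<in> {0..1 - 2 * \<delta> k} \<Longrightarrow> \<bar>\<gamma> k s - g s\<bar> \<le> M * \<delta> k"
    and \<Phi>\<delta>: "\<And>k s. s \<in> {0..1} \<Longrightarrow> \<bar>\<Phi> k s - F s\<bar> \<le> M * \<delta> k"
    by metis
  define \<phi> where "\<phi> k x = \<Phi> k ((norm x)\<^sup>2)" for k and x :: "real^'n"
  have d\<phi>: "(\<phi> k has_derivative (\<lambda>v. ((- 2 * \<gamma> k ((norm x)\<^sup>2)) *\<^sub>R x) \<bullet> v)) (at x)" for k x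
    unfolding \<phi>_def[abs_def] by (rule has_derivative_radial[OF d\<Phi>])
  have g\<phi>: "grad (\<phi> k) x = (- 2 * \<gamma> k ((norm x)\<^sup>2)) *\<^sub>R x" for k x
    by (rule grad_eq[OF d\<phi>])
  have sq: "(norm x)\<^sup>2 \<in> {0..1}" "norm x \<le> 1" if "x \<in> ?B" for x
    using that by (auto simp: power_le_one)
  have M0: "0 \<le> M"
    using \<gamma>M[of 0 0] by (smt (verit) atLeastAtMost_iff)
  have test: "\<phi> k \<in> test_functions ?B" for k
  proof -
    have "{x. \<phi> k x \<noteq> 0} \<subseteq> {x. (norm x)\<^sup>2 \<le> 1 - \<delta> k}"
    proof safe
      fix x assume "\<phi> k x \<noteq> 0"
      then show "(norm x)\<^sup>2 \<le> 1 - \<delta> k"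
        using \<Phi>0[of k "(norm x)\<^sup>2"] unfolding \<phi>_def by linarith
    qed
    moreover have "closed {x::real^'n. (norm x)\<^sup>2 \<le> 1 - \<delta> k}"
      by (intro closed_Collect_le continuous_intros)
    ultimately have "closure {x. \<phi> k x \<noteq> 0} \<subseteq> {x. (norm x)\<^sup>2 \<le> 1 - \<delta> k}"
      by (rule closure_minimal)
    also have "\<dots> \<subseteq> ?B"
    proof
      fix x :: "real^'n" assume "x \<in> {x. (norm x)\<^sup>2 \<le> 1 - \<delta> k}"
      then have "(norm x)\<^sup>2 < 1\<^sup>2" using \<delta>(1)[of k] by simp
      then show "x \<in> ?B" using power_less_imp_less_base by fastforce
    qed
    finally have sub: "closure {x. \<phi> k x \<noteq> 0} \<subseteq> ?B" .
    then have "bounded (closure {x. \<phi> k x \<noteq> 0})"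
      using bounded_ball bounded_subset by blast
    then have "compact (closure {x. \<phi> k x \<noteq> 0})"
      by (simp add: compact_eq_bounded_closed)
    moreover have "Ck j (\<phi> k)" for j
      unfolding \<phi>_def by (rule Ck_compose[OF C\<Phi> Ck_norm_squared])
    ultimately show ?thesis using sub by (simp add: test_functions_def)
  qed
  have c\<phi>: "continuous_on UNIV (\<phi> k)" for k
    using test[of k] by (auto simp: test_functions_def dest: Ck_imp_continuous)
  obtain A where A: "\<And>x. x \<in> ?B \<Longrightarrow> norm (G x) \<le> A" using bdd[OF cG] by blast
  have lim0: "(\<lambda>k. Lp_norm p ?B (\<lambda>x. \<phi> k x - u x)) \<longlonglongrightarrow> 0"
  proof (rule Lp_norm_tendsto_0[OF _ p])
    show "(\<lambda>x. \<phi> k x - u x) \<in> borel_measurable (lebesgue_on ?B)" for k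
      by (intro borel_measurable_lebesgue_on_continuous continuous_intros c\<phi> cu)
    have b: "norm (\<phi> k x - u x) \<le> M * \<delta> k" if "x \<in> ?B" for k x
      using \<Phi>\<delta>[OF sq(1)[OF that]] by (simp add: \<phi>_def u_def)
    show "norm (\<phi> k x - u x) \<le> M" if "x \<in> ?B" for k x
      using b[OF that, of k] mult_left_le[OF _ M0, of "\<delta> k"] \<delta>(2)[of k] by linarith
    show "(\<lambda>k. \<phi> k x - u x) \<longlonglongrightarrow> 0" if "x \<in> ?B" for x
      by (rule Lim_null_comparison[where g="\<lambda>k. M * \<delta> k"])
        (use b[OF that] tendsto_mult_right_zero[OF \<delta>0] in auto)
  qed auto
  have lim1: "(\<lambda>k. Lp_norm p ?B (\<lambda>x. grad (\<phi> k) x - G x)) \<longlonglongrightarrow> 0"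
  proof (rule Lp_norm_tendsto_0[OF _ p])
    show "(\<lambda>x. grad (\<phi> k) x - G x) \<in> borel_measurable (lebesgue_on ?B)" for k
      by (intro borel_measurable_lebesgue_on_continuous continuous_intros cG test_function_grad(2)[OF test])
    show "norm (grad (\<phi> k) x - G x) \<le> 2 * M + A" if "x \<in> ?B" for k x
    proof -
      have "norm (grad (\<phi> k) x) = 2 * (\<bar>\<gamma> k ((norm x)\<^sup>2)\<bar> * norm x)"
        unfolding g\<phi> by (simp add: abs_mult)
      also have "\<dots> \<le> 2 * (M * 1)"
        using \<gamma>M[OF sq(1)[OF that]] sq(2)[OF that] M0 by (intro mult_left_mono mult_mono) auto
      finally show ?thesis using A[OF that] norm_triangle_ineq4[of "grad (\<phi> k) x" "G x"] by linarith
    qed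
    show "(\<lambda>k. grad (\<phi> k) x - G x) \<longlonglongrightarrow> 0" if "x \<in> ?B" for x
    proof (rule Lim_null_comparison[where g="\<lambda>k. 2 * (M * \<delta> k)"])
      \<comment> \<open>A fixed interior point eventually leaves the boundary layer, after which the
        estimate of order \<open>\<delta> k\<close> applies to it.\<close>
      have "(norm x)\<^sup>2 < 1" using that by (simp add: power_less_one_iff)
      then have "\<forall>\<^sub>F k in sequentially. \<delta> k < (1 - (norm x)\<^sup>2) / 2"
        by (intro order_tendstoD(2)[OF \<delta>0]) auto
      then show "\<forall>\<^sub>F k in sequentially. norm (grad (\<phi> k) x - G x) \<le> 2 * (M * \<delta> k)"
      proof eventually_elim
        case (elim k)
        have "grad (\<phi> k) x - G x = (- 2 * (\<gamma> k ((norm x)\<^sup>2) - g ((norm x)\<^sup>2))) *\<^sub>R x"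
          unfolding g\<phi> G_def by (simp add: algebra_simps)
        then have "norm (grad (\<phi> k) x - G x) = 2 * \<bar>\<gamma> k ((norm x)\<^sup>2) - g ((norm x)\<^sup>2)\<bar> * norm x"
          by (simp only: norm_scaleR abs_mult)
        also have "\<dots> \<le> 2 * (M * \<delta> k) * 1"
          using elim \<gamma>\<delta>[of "(norm x)\<^sup>2" k] sq[OF that] M0 \<delta>(1)[of k]
          by (intro mult_mono mult_left_mono) auto
        finally show ?case by simp
      qed
      show "(\<lambda>k. 2 * (M * \<delta> k)) \<longlonglongrightarrow> 0"
        by (intro tendsto_mult_right_zero \<delta>0)
    qed
  qed auto
  have "weak_gradient ?B u G"
    by (rule weak_gradient_C1[OF u cG]) auto
  then have "u \<in> W0_1p p ?B"
    unfolding W0_1p_def using Lp[OF cu] Lp[OF cG] test lim0 lim1 by blast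
  then show ?thesis by (simp add: u_def[abs_def])
qed

section \<open>Essential bounds and Luxemburg norms\<close>

lemma emeasure_lborel_ball:
  fixes c :: "'a::euclidean_space"
  assumes "0 \<le> r"
  shows "emeasure lborel (ball c r) = ennreal (r ^ DIM('a) * measure lborel (ball (0::'a) 1))"
proof -
  have "emeasure lborel (ball c r) = ennreal (measure lborel (ball c r))"
    by (rule emeasure_eq_ennreal_measure) (use emeasure_bounded_finite[of "ball c r"] in auto)
  then show ?thesis
    using content_ball_conv_unit_ball[OF assms, of c] by simp
qed

lemma ess_sup_ge:
  assumes "\<Omega> \<in> sets lebesgue" "A \<in> sets lebesgue" "A \<subseteq> \<Omega>" "emeasure lebesgue A \<noteq> 0"
    and "\<And>x. x \<in> A \<Longrightarrow> c \<le> ereal (u x)"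
  shows "c \<le> ess_sup \<Omega> u"
proof (rule ccontr)
  assume "\<not> c \<le> ess_sup \<Omega> u"
  moreover have "AE x in lebesgue_on \<Omega>. ereal (u x) \<le> ess_sup \<Omega> u"
    unfolding ess_sup_def by (rule esssup_AE)
  ultimately have "AE x in lebesgue_on \<Omega>. x \<notin> A"
    using assms(5) by (elim eventually_mono) (meson order_trans)
  then have "AE x in lebesgue. x \<notin> A"
    using assms(1,3) by (subst (asm) AE_restrict_space_iff) (auto elim!: eventually_mono)
  then have "A \<in> null_sets lebesgue"
    using AE_iff_null_sets[OF assms(2)] by simp
  then show False
    using assms(4) by (simp only: null_setsD1)
qed

lemma ess_sup_le:
  assumes "u \<in> borel_measurable (lebesgue_on \<Omega>)" "\<And>x. x \<in> \<Omega> \<Longrightarrow> u x \<le> c"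
  shows "ess_sup \<Omega> u \<le> ereal c"
  unfolding ess_sup_def using assms by (intro esssup_I AE_I2) auto

lemma ess_inf_eq_ess_sup: "ess_inf \<Omega> u = - ess_sup \<Omega> (\<lambda>x. - u x)"
  by (simp add: ess_inf_def ess_sup_def)

section \<open>Two-sided estimates of Luxemburg norms\<close>

lemma luxemburg_norm_le:
  assumes "0 < c" "(\<integral>\<^sup>+x. ennreal (\<Phi> (\<bar>v x\<bar> / c)) \<partial>lebesgue_on \<Omega>) \<le> 1"
  shows "luxemburg_norm \<Phi> \<Omega> v \<le> ereal c"
  unfolding luxemburg_norm_def using assms by (intro Inf_lower) auto

lemma luxemburg_norm_nonneg: "0 \<le> luxemburg_norm \<Phi> \<Omega> v"
  unfolding luxemburg_norm_def by (intro Inf_greatest) auto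

lemma N_fun_le:
  assumes "2 \<le> n" "0 < s" "0 \<le> t"
  shows "N_fun n s t \<le> t * ln (t + 1) powr ((real n - 1) / s)"
proof -
  let ?a = "(real n - 1) / s"
  have a: "0 < ?a" using assms by simp
  have "N_fun n s t \<le> integral {0..t} (\<lambda>_. ln (t + 1) powr ?a)"
    unfolding N_fun_def
  proof (rule integral_le)
    have "continuous_on {0..t} (\<lambda>\<tau>. ln (\<tau> + 1) powr ?a)"
      by (intro continuous_on_powr' continuous_intros) (use a in auto)
    then show "(\<lambda>\<tau>. ln (\<tau> + 1) powr ?a) integrable_on {0..t}"
      by (rule integrable_continuous_real)
  qed (use a in \<open>auto intro!: powr_mono2\<close>)
  then show ?thesis
    using assms by simp
qed

text \<open>Summation over dyadic shells: \<open>1/|x| \<le> 2\<^sup>k\<^sup>+\<^sup>1\<close> for \<open>2\<^sup>-\<^sup>k\<^sup>-\<^sup>1 \<le> |x| < 2\<^sup>-\<^sup>k\<close>.\<close>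

lemma nn_integral_inverse_norm_le:
  assumes "2 \<le> DIM('a::euclidean_space)"
  shows "(\<integral>\<^sup>+x. ennreal (1 / norm x) \<partial>lebesgue_on (ball (0::'a) 1))
    \<le> ennreal (4 * measure lborel (ball (0::'a) 1))"
proof -
  define \<omega> where "\<omega> = measure lborel (ball (0::'a) 1)"
  have \<omega>: "0 \<le> \<omega>" by (simp add: \<omega>_def)
  define f where "f k x = ennreal (2 ^ Suc k) * indicator (ball 0 ((1/2) ^ k)) x" for k and x :: 'a
  have le: "ennreal (1 / norm x) * indicator (ball 0 1) x \<le> (\<Sum>k. f k x)" for x :: 'a
  proof (cases "x \<noteq> 0 \<and> norm x < 1")
    case True
    define k where "k = (LEAST k. (1/2::real) ^ Suc k \<le> norm x)"
    have "\<exists>k. (1/2::real) ^ k < norm x"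
      using True by (intro real_arch_pow_inv) auto
    then obtain j where "(1/2::real) ^ j < norm x" by blast
    moreover have "(1/2::real) ^ Suc j \<le> (1/2) ^ j" by simp
    ultimately have "(1/2::real) ^ Suc j \<le> norm x" by linarith
    then have k1: "(1/2::real) ^ Suc k \<le> norm x"
      unfolding k_def by (rule LeastI)
    have k2: "norm x < (1/2::real) ^ k"
    proof (cases k)
      case 0
      then show ?thesis using True by simp
    next
      case (Suc i)
      then have "\<not> (1/2::real) ^ Suc i \<le> norm x"
        unfolding k_def by (intro not_less_Least) simp
      then show ?thesis using Suc by simp
    qed
    have "1 / norm x \<le> 1 / (1/2) ^ Suc k"
      using k1 True by (intro divide_left_mono) auto
    then have "1 / norm x \<le> 2 ^ Suc k"
      by (simp add: power_divide)
    then have "ennreal (1 / norm x) * indicator (ball 0 1) x \<le> f k x"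
      using True k2 by (simp add: f_def ennreal_leI)
    also have "\<dots> = (\<Sum>k\<in>{k}. f k x)" by simp
    also have "\<dots> \<le> (\<Sum>k. f k x)" by (rule sum_le_suminf) auto
    finally show ?thesis .
  qed (auto simp: indicator_def)
  have "(\<integral>\<^sup>+x. ennreal (1 / norm x) \<partial>lebesgue_on (ball (0::'a) 1))
      = (\<integral>\<^sup>+x. ennreal (1 / norm x) * indicator (ball (0::'a) 1) x \<partial>lebesgue)"
    by (rule nn_integral_restrict_space) auto
  also have "\<dots> \<le> (\<integral>\<^sup>+x. (\<Sum>k. f k x) \<partial>lebesgue)"
    by (rule nn_integral_mono) (rule le)
  also have "\<dots> = (\<Sum>k. \<integral>\<^sup>+x. f k x \<partial>lebesgue)"
    unfolding f_def
    by (intro nn_integral_suminf borel_measurable_times_ennreal borel_measurable_const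
        borel_measurable_indicator) auto
  also have "\<dots> \<le> (\<Sum>k. ennreal (2 * \<omega> * (1/2) ^ k))"
  proof (rule suminf_le)
    show "(\<integral>\<^sup>+x. f k x \<partial>lebesgue) \<le> ennreal (2 * \<omega> * (1/2) ^ k)" for k
    proof -
      \<comment> \<open>Lowering the exponent from the dimension to 2 leaves
        \<open>2 ^ Suc k * (1/2) ^ (2 * k) = 2 * (1/2) ^ k\<close> per shell, a geometric series
        that explains the constant 4.\<close>
      have "((1/2::real) ^ k) ^ DIM('a) \<le> ((1/2::real) ^ k)\<^sup>2"
        using assms by (intro power_decreasing) (auto simp: power_le_one)
      then have "2 ^ Suc k * (((1/2::real) ^ k) ^ DIM('a) * \<omega>) \<le> 2 ^ Suc k * (((1/2::real) ^ k)\<^sup>2 * \<omega>)"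
        using \<omega> by (intro mult_left_mono mult_right_mono) auto
      also have "\<dots> = 2 * \<omega> * (1/2) ^ k"
        by (simp add: power2_eq_square power_divide)
      finally have "2 ^ Suc k * (((1/2::real) ^ k) ^ DIM('a) * \<omega>) \<le> 2 * \<omega> * (1/2) ^ k" .
      moreover have "(\<integral>\<^sup>+x. f k x \<partial>lebesgue) = ennreal (2 ^ Suc k * (((1/2::real) ^ k) ^ DIM('a) * \<omega>))"
        unfolding f_def by (subst nn_integral_cmult_indicator)
          (simp_all add: emeasure_lborel_ball ennreal_mult \<omega>_def del: power_Suc)
      ultimately show ?thesis by (simp add: ennreal_leI del: power_Suc)
    qed
  qed auto
  also have "\<dots> = ennreal (\<Sum>k. 2 * \<omega> * (1/2) ^ k)"
    using \<omega> by (intro suminf_ennreal2 summable_mult) (auto intro: summable_geometric)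
  also have "(\<Sum>k. 2 * \<omega> * (1/2::real) ^ k) = 4 * \<omega>"
    by (subst suminf_mult) (simp_all add: suminf_geometric summable_geometric)
  finally show ?thesis by (simp add: \<omega>_def)
qed

text \<open>Since \<open>q \<ge> 1\<close>, the choice of \<open>\<lambda>\<close> gives \<open>(v/\<lambda>)\<^sup>q \<le> v/K\<close>, and
  \<open>exp (v/K) - 1 \<le> exp v / K \<le> 1/(K|x|)\<close>.\<close>

lemma luxemburg_norm_exp_le:
  fixes v :: "'a::euclidean_space \<Rightarrow> real"
  assumes dim: "2 \<le> DIM('a)" and q: "1 \<le> q" and T: "0 < T"
    and v: "\<And>x. x \<in> ball 0 1 \<Longrightarrow> 0 \<le> v x" "\<And>x. x \<in> ball 0 1 \<Longrightarrow> v x \<le> T"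
    and log: "\<And>x. x \<in> ball 0 1 \<Longrightarrow> x \<noteq> 0 \<Longrightarrow> v x \<le> - ln (norm x)"
    and K: "1 \<le> K" "4 * measure lborel (ball (0::'a) 1) \<le> K"
  shows "luxemburg_norm (\<lambda>t. exp (t powr q) - 1) (ball 0 1) v \<le> ereal ((K * T powr (q - 1)) powr (1 / q))"
proof (rule luxemburg_norm_le)
  define l where "l = (K * T powr (q - 1)) powr (1 / q)"
  have KT: "0 < K * T powr (q - 1)" using K T by simp
  then show l0: "0 < (K * T powr (q - 1)) powr (1 / q)" using K T by simp
  have lq: "l powr q = K * T powr (q - 1)"
    unfolding l_def powr_powr using q K T by simp
  have pw: "exp ((\<bar>v x\<bar> / l) powr q) - 1 \<le> (1 / K) * (1 / norm x)"
    if x: "x \<in> ball 0 1" "x \<noteq> 0" for x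
  proof -
    have "v x powr q = v x * v x powr (q - 1)"
      using v(1)[OF x(1)] q by (cases "v x = 0") (auto simp: powr_mult_base)
    also have "\<dots> \<le> v x * T powr (q - 1)"
      using v[OF x(1)] q by (intro mult_left_mono powr_mono2) auto
    finally have "v x powr q / l powr q \<le> v x * T powr (q - 1) / (K * T powr (q - 1))"
      unfolding lq using KT by (intro divide_right_mono) auto
    also have "\<dots> = v x / K" using T by simp
    finally have le: "(\<bar>v x\<bar> / l) powr q \<le> v x / K"
      using v(1)[OF x(1)] l0 by (simp add: powr_divide l_def)
    \<comment> \<open>Convexity of \<open>exp\<close> on the segment from 0 to \<open>v x\<close>,
      at parameter \<open>1/K\<close>; this uses \<open>K \<ge> 1\<close>. The bound
      \<open>4 * measure lborel (ball 0 1) \<le> K\<close> later absorbs the integral of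
      \<open>1/|x|\<close>.\<close>
    have "exp (v x / K) \<le> 1 + (exp (v x) - 1) / K"
    proof -
      have "exp ((1 - 1/K) *\<^sub>R 0 + (1/K) *\<^sub>R v x) \<le> (1 - 1/K) * exp 0 + (1/K) * exp (v x)"
        using K by (intro convex_onD[OF exp_convex]) auto
      then show ?thesis by (simp add: diff_divide_distrib left_diff_distrib)
    qed
    then have "exp ((\<bar>v x\<bar> / l) powr q) - 1 \<le> (exp (v x) - 1) / K"
      using le by (smt (verit) exp_le_cancel_iff)
    also have "\<dots> \<le> (1 / norm x) / K"
    proof (rule divide_right_mono)
      have "exp (v x) \<le> exp (- ln (norm x))" using log[OF x] by simp
      also have "\<dots> = 1 / norm x" using x by (simp add: exp_minus divide_inverse)
      finally show "exp (v x) - 1 \<le> 1 / norm x" by simp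
    qed (use K in auto)
    finally show ?thesis by (simp add: field_simps)
  qed
  have "AE x in lebesgue_on (ball (0::'a) 1). ennreal (exp ((\<bar>v x\<bar> / l) powr q) - 1) \<le> ennreal (1 / K) * ennreal (1 / norm x)"
  proof -
    \<comment> \<open>The origin has to be excluded: there \<open>1 / norm x\<close> is 0 by
      convention and bounds nothing.\<close>
    have "AE x in lebesgue. (x::'a) \<noteq> 0"
      by (rule AE_I'[of "{0}"]) (auto simp: negligible_iff_null_sets[symmetric])
    then have "AE x in lebesgue_on (ball (0::'a) 1). x \<noteq> 0"
      by (subst AE_restrict_space_iff) auto
    then show ?thesis
      by (rule AE_mp) (use pw K in \<open>auto intro!: AE_I2 ennreal_leI simp: ennreal_mult[symmetric]\<close>)
  qed
  then have "(\<integral>\<^sup>+x. ennreal (exp ((\<bar>v x\<bar> / l) powr q) - 1) \<partial>lebesgue_on (ball 0 1))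
      \<le> (\<integral>\<^sup>+x. ennreal (1 / K) * ennreal (1 / norm x) \<partial>lebesgue_on (ball (0::'a) 1))"
    by (rule nn_integral_mono_AE)
  also have "\<dots> = ennreal (1 / K) * (\<integral>\<^sup>+x. ennreal (1 / norm x) \<partial>lebesgue_on (ball (0::'a) 1))"
  proof (rule nn_integral_cmult)
    have "(\<lambda>x::'a. ennreal (1 / norm x)) \<in> borel_measurable lebesgue"
      by (rule measurable_completion) (simp, measurable)
    then show "(\<lambda>x::'a. ennreal (1 / norm x)) \<in> borel_measurable (lebesgue_on (ball 0 1))"
      by (rule measurable_restrict_space1)
  qed
  also have "\<dots> \<le> ennreal (1 / K) * ennreal K"
    using nn_integral_inverse_norm_le[OF dim] K(2)
    by (intro mult_left_mono) (auto intro: order_trans ennreal_leI)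
  also have "\<dots> = 1"
    using K by (simp add: ennreal_mult[symmetric])
  finally show "(\<integral>\<^sup>+x. ennreal (exp ((\<bar>v x\<bar> / (K * T powr (q - 1)) powr (1 / q)) powr q) - 1)
      \<partial>lebesgue_on (ball 0 1)) \<le> 1"
    by (simp add: l_def)
qed

text \<open>Because \<open>exp t - 1 \<ge> t\<close>, every admissible \<open>c\<close> satisfies
  \<open>(1/c)^q m \<le> 1\<close>, where \<open>m\<close> is the measure of the small ball; so
  \<open>c\<close> is at least \<open>m^(1/q)\<close>. This keeps the ratio in (A) from being a
  division by zero.\<close>

lemma luxemburg_norm_exp_pos:
  fixes v :: "'a::euclidean_space \<Rightarrow> real"
  assumes q: "0 < q" and r: "0 < r" "ball 0 r \<subseteq> \<Omega>" and \<Omega>: "\<Omega> \<in> sets lebesgue"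
    and v: "\<And>x. x \<in> ball 0 r \<Longrightarrow> 1 \<le> v x"
  shows "0 < luxemburg_norm (\<lambda>t. exp (t powr q) - 1) \<Omega> v"
proof -
  define m where "m = r ^ DIM('a) * measure lborel (ball (0::'a) 1)"
  have m: "0 < m" using r by (simp add: m_def)
  have "ereal ((1 / m) powr (- 1 / q)) \<le> luxemburg_norm (\<lambda>t. exp (t powr q) - 1) \<Omega> v"
    unfolding luxemburg_norm_def
  proof (rule Inf_greatest, clarify)
    fix c :: real
    assume c: "0 < c" and le: "(\<integral>\<^sup>+x. ennreal (exp ((\<bar>v x\<bar> / c) powr q) - 1) \<partial>lebesgue_on \<Omega>) \<le> 1"
    have "ennreal ((1 / c) powr q * m) = (\<integral>\<^sup>+x. ennreal ((1 / c) powr q) * indicator (ball (0::'a) r) x \<partial>lebesgue)"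
      using r by (subst nn_integral_cmult_indicator) (auto simp: emeasure_lborel_ball m_def ennreal_mult)
    also have "\<dots> \<le> (\<integral>\<^sup>+x. ennreal (exp ((\<bar>v x\<bar> / c) powr q) - 1) * indicator \<Omega> x \<partial>lebesgue)"
    proof (rule nn_integral_mono)
      fix x :: 'a
      show "ennreal ((1 / c) powr q) * indicator (ball 0 r) x \<le> ennreal (exp ((\<bar>v x\<bar> / c) powr q) - 1) * indicator \<Omega> x"
      proof (cases "x \<in> ball 0 r")
        case True
        have "(1 / c) powr q \<le> (\<bar>v x\<bar> / c) powr q"
          using v[OF True] c q by (intro powr_mono2 divide_right_mono) auto
        also have "\<dots> \<le> exp ((\<bar>v x\<bar> / c) powr q) - 1"
          using exp_ge_add_one_self[of "(\<bar>v x\<bar> / c) powr q"] by linarith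
        finally have "(1 / c) powr q \<le> exp ((\<bar>v x\<bar> / c) powr q) - 1" .
        moreover have "x \<in> \<Omega>" using True r(2) by blast
        ultimately show ?thesis using True by (simp add: ennreal_leI)
      qed simp
    qed
    also have "\<dots> \<le> 1"
      using le \<Omega> by (subst (asm) nn_integral_restrict_space) auto
    finally have "(1 / c) powr q * m \<le> 1" by simp
    then have "(1 / c) powr q \<le> 1 / m" using m by (simp add: field_simps)
    then have "((1 / c) powr q) powr (1 / q) \<le> (1 / m) powr (1 / q)"
      using q by (intro powr_mono2) auto
    then have "1 / c \<le> (1 / m) powr (1 / q)"
      using q c by (simp add: powr_powr)
    then have "inverse ((1 / m) powr (1 / q)) \<le> c"
      using c by (metis divide_inverse inverse_inverse_eq inverse_positive_iff_positive le_imp_inverse_le mult_1)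
    then show "ereal ((1 / m) powr (- 1 / q)) \<le> ereal c"
      by (simp add: powr_minus[symmetric])
  qed
  moreover have "0 < ereal ((1 / m) powr (- 1 / q))" using m by simp
  ultimately show ?thesis by (rule less_le_trans[rotated])
qed

section \<open>The Moser functions as solutions\<close>

text \<open>The variable \<open>s\<close> stands for \<open>|x|^2\<close>, whence the factor
  \<open>1/2\<close>. The linear branch also covers negative \<open>s\<close>, so the profile is
  differentiable on the whole line, as the radial lemmas demand.\<close>

definition capped_log :: "real \<Rightarrow> real \<Rightarrow> real" where
  "capped_log \<epsilon> s = (if s \<le> \<epsilon>\<^sup>2 then - ln \<epsilon> + (1 - s / \<epsilon>\<^sup>2) / 2 else - ln s / 2)"

definition moser :: "real \<Rightarrow> real ^ 'n \<Rightarrow> real" where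
  "moser \<epsilon> x = capped_log \<epsilon> ((norm x)\<^sup>2)"

text \<open>On the cap the gradient is \<open>-x/\<epsilon>^2\<close>, so the flux is
  \<open>-|x|^(n-2) x / \<epsilon>^(2(n-1))\<close>. Minus its divergence is
  \<open>(n + (n-2)) |x|^(n-2) / \<epsilon>^(2(n-1))\<close>; division by \<open>u^(n-1)\<close>
  gives the formula.\<close>

definition moser_potential :: "real \<Rightarrow> real ^ 'n \<Rightarrow> real" where
  "moser_potential \<epsilon> x = (if norm x < \<epsilon>
     then 2 * (real CARD('n) - 1) * norm x ^ (CARD('n) - 2) /
       (\<epsilon>\<^sup>2 ^ (CARD('n) - 1) * moser \<epsilon> x ^ (CARD('n) - 1))
     else 0)"

text \<open>Writing the slope with \<open>max\<close> joins both branches in one visibly continuous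
  expression. At the joint the left and right difference quotients are those of the tangent and of
  the logarithm.\<close>

lemma capped_log_has_derivative:
  assumes \<epsilon>: "0 < \<epsilon>"
  shows "(capped_log \<epsilon> has_real_derivative - (1 / (2 * max s (\<epsilon>\<^sup>2)))) (at s)"
proof -
  let ?A = "\<lambda>s. - ln \<epsilon> + (1 - s / \<epsilon>\<^sup>2) / 2" and ?B = "\<lambda>s. - ln s / 2"
  have A: "(?A has_real_derivative - (1 / (2 * \<epsilon>\<^sup>2))) (at s)"
  proof -
    have "(?A has_real_derivative 0 + (0 - 1 / \<epsilon>\<^sup>2) / 2) (at s)"
      by (intro DERIV_add DERIV_const DERIV_cdivide DERIV_diff DERIV_ident)
    then show ?thesis by (rule DERIV_cong) simp
  qed
  have B: "(?B has_real_derivative - (1 / (2 * s))) (at s)" if "0 < s"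
  proof -
    have "(?B has_real_derivative - (1 / s) / 2) (at s)"
      by (intro DERIV_cdivide DERIV_minus DERIV_ln_divide that)
    then show ?thesis by (rule DERIV_cong) simp
  qed
  have \<epsilon>2: "0 < \<epsilon>\<^sup>2" using \<epsilon> by simp
  show ?thesis
  proof (cases s "\<epsilon>\<^sup>2" rule: linorder_cases)
    case less
    have "(capped_log \<epsilon> has_real_derivative - (1 / (2 * \<epsilon>\<^sup>2))) (at s)"
      by (rule has_field_derivative_transform_within_open[OF A, where S="{..<\<epsilon>\<^sup>2}"])
        (use less in \<open>auto simp: capped_log_def\<close>)
    then show ?thesis using less by simp
  next
    case greater
    have s0: "0 < s" using greater \<epsilon>2 by linarith
    have "(capped_log \<epsilon> has_real_derivative - (1 / (2 * s))) (at s)"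
      by (rule has_field_derivative_transform_within_open[OF B[OF s0], where S="{\<epsilon>\<^sup>2<..}"])
        (use greater in \<open>auto simp: capped_log_def\<close>)
    then show ?thesis using greater by simp
  next
    case equal
    have AB: "?A s = ?B s" "capped_log \<epsilon> s = ?A s"
      using equal \<epsilon> by (auto simp: capped_log_def ln_realpow)
    have "((\<lambda>y. (capped_log \<epsilon> y - capped_log \<epsilon> s) / (y - s)) \<longlongrightarrow> - (1 / (2 * \<epsilon>\<^sup>2))) (at_left s)"
    proof (rule Lim_transform_eventually)
      show "((\<lambda>y. (?A y - ?A s) / (y - s)) \<longlongrightarrow> - (1 / (2 * \<epsilon>\<^sup>2))) (at_left s)"
        using A by (simp only: has_field_derivative_iff filterlim_at_split)
      show "\<forall>\<^sub>F y in at_left s. (?A y - ?A s) / (y - s) = (capped_log \<epsilon> y - capped_log \<epsilon> s) / (y - s)"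
        unfolding eventually_at_filter using equal AB by (auto simp: capped_log_def)
    qed
    moreover have "((\<lambda>y. (capped_log \<epsilon> y - capped_log \<epsilon> s) / (y - s)) \<longlongrightarrow> - (1 / (2 * s))) (at_right s)"
    proof (rule Lim_transform_eventually)
      show "((\<lambda>y. (?B y - ?B s) / (y - s)) \<longlongrightarrow> - (1 / (2 * s))) (at_right s)"
        using B \<epsilon>2 equal by (simp only: has_field_derivative_iff filterlim_at_split)
      show "\<forall>\<^sub>F y in at_right s. (?B y - ?B s) / (y - s) = (capped_log \<epsilon> y - capped_log \<epsilon> s) / (y - s)"
        unfolding eventually_at_filter using equal AB by (auto simp: capped_log_def)
    qed
    ultimately show ?thesis
      using equal by (simp add: has_field_derivative_iff filterlim_at_split)
  qed
qed

lemma capped_log_mono: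
  assumes "0 < \<epsilon>" "s \<le> t"
  shows "capped_log \<epsilon> t \<le> capped_log \<epsilon> s"
proof (rule DERIV_nonpos_imp_nonincreasing[OF assms(2)])
  fix x
  have "0 < max x (\<epsilon>\<^sup>2)" using assms(1) by (simp add: less_max_iff_disj)
  then show "\<exists>y. (capped_log \<epsilon> has_real_derivative y) (at x) \<and> y \<le> 0"
    using capped_log_has_derivative[OF assms(1), of x]
    by (intro exI[of _ "- (1 / (2 * max x (\<epsilon>\<^sup>2)))"]) auto
qed

text \<open>A convex function lies above its tangents; for the logarithm this is
  \<open>ln y \<le> y - 1\<close> with \<open>y = s / \<epsilon>^2\<close>.\<close>

lemma capped_log_le:
  assumes "0 < \<epsilon>" "0 < s"
  shows "capped_log \<epsilon> s \<le> - ln s / 2"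
proof (cases "s \<le> \<epsilon>\<^sup>2")
  case True
  define y where "y = s / \<epsilon>\<^sup>2"
  have "ln y \<le> y - 1"
    using assms unfolding y_def by (intro ln_le_minus_one) simp
  moreover have "ln y = ln s - 2 * ln \<epsilon>"
    using assms by (simp add: y_def ln_div ln_realpow)
  moreover have "capped_log \<epsilon> s = - ln \<epsilon> + (1 - y) / 2"
    using True by (simp add: capped_log_def y_def)
  ultimately show ?thesis by (simp add: field_simps)
qed (simp add: capped_log_def)

text \<open>The \<open>itself\<close> parameter fixes the dimension type. The bound
  \<open>1/8\<close> places the cap inside the ball used for the Harnack ratio and, since
  \<open>8 > e\<close>, makes \<open>- ln \<epsilon>\<close> at least 1.\<close>

locale moser_family =
  fixes \<epsilon> :: real and dim_type :: "'n::finite itself"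
  assumes \<epsilon>: "0 < \<epsilon>" "\<epsilon> < 1/8" and dim: "2 \<le> CARD('n)"
begin

abbreviation "u \<equiv> moser \<epsilon> :: real^'n \<Rightarrow> real"
abbreviation "V \<equiv> moser_potential \<epsilon> :: real^'n \<Rightarrow> real"
abbreviation "B \<equiv> ball 0 1 :: (real^'n) set"

lemma ln_\<epsilon>: "1 \<le> - ln \<epsilon>"
proof -
  have "exp 1 < (8::real)" using e_less_272 by simp
  then have "1 < ln (8::real)" using ln_less_cancel_iff[of "exp 1" "8::real"] by simp
  moreover have "ln 8 \<le> - ln \<epsilon>"
    using \<epsilon> ln_le_cancel_iff[of 8 "1 / \<epsilon>"] by (simp add: ln_div field_simps)
  ultimately show ?thesis by simp
qed

lemma u_le_log: "x \<noteq> 0 \<Longrightarrow> u x \<le> - ln (norm x)"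
  using capped_log_le[OF \<epsilon>(1), of "(norm x)\<^sup>2"] by (simp add: moser_def ln_realpow)

lemma u_antimono: "norm x \<le> norm y \<Longrightarrow> u y \<le> u x"
  unfolding moser_def by (intro capped_log_mono \<epsilon>) (simp add: power_mono)

lemma u_eq_log: "\<epsilon> \<le> norm x \<Longrightarrow> u x = - ln (norm x)"
proof (cases "norm x = \<epsilon>")
  case True
  then show ?thesis using \<epsilon> by (simp add: moser_def capped_log_def)
next
  case False
  assume "\<epsilon> \<le> norm x"
  with False have "\<epsilon>\<^sup>2 < (norm x)\<^sup>2" "0 < norm x"
    using \<epsilon> by (auto intro: power_strict_mono)
  then show ?thesis by (simp add: moser_def capped_log_def ln_realpow)
qed

lemma u_le: "u x \<le> - ln \<epsilon> + 1/2"
  using capped_log_mono[OF \<epsilon>(1), of 0 "(norm x)\<^sup>2"] by (simp add: moser_def capped_log_def)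

lemma u_ge: "norm x \<le> \<epsilon> \<Longrightarrow> - ln \<epsilon> \<le> u x"
  using capped_log_mono[OF \<epsilon>(1), of "(norm x)\<^sup>2" "\<epsilon>\<^sup>2"] \<epsilon>
  by (simp add: moser_def capped_log_def power_mono)

lemma u_pos:
  assumes "x \<in> B"
  shows "0 < u x"
proof (cases "\<epsilon> \<le> norm x")
  case True
  then have "ln (norm x) < 0"
    using assms \<epsilon> by (subst ln_less_zero_iff) auto
  then show ?thesis using u_eq_log[OF True] by simp
next
  case False
  then show ?thesis using u_ge[of x] ln_\<epsilon> by simp
qed

text \<open>By radial monotonicity it is enough to evaluate \<open>u\<close> on the sphere of radius
  \<open>1/8\<close>, which lies in the logarithmic region.\<close>

lemma u_ge_8: "x \<in> ball 0 (1/8) \<Longrightarrow> ln 8 \<le> u x"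
proof -
  assume "x \<in> ball 0 (1/8)"
  obtain y :: "real^'n" where y: "norm y = 1/8"
    using vector_choose_size[of "1/8"] by auto
  then have "u y = - ln (1/8)" using u_eq_log[of y] \<epsilon> by (simp only:)
  then have "u y = ln 8" by (simp add: ln_div)
  then show ?thesis using u_antimono[of x y] y \<open>x \<in> _\<close> by simp
qed

lemma u_has_derivative:
  "(u has_derivative (\<lambda>v. ((- (1 / max ((norm x)\<^sup>2) (\<epsilon>\<^sup>2))) *\<^sub>R x) \<bullet> v)) (at x)"
  using has_derivative_radial[OF capped_log_has_derivative[OF \<epsilon>(1)], of x]
  by (simp add: moser_def[abs_def])

lemma u_continuous: "continuous_on UNIV u"
  using u_has_derivative by (meson continuous_at_imp_continuous_on has_derivative_continuous)

lemma max_pos: "0 < max s (\<epsilon>\<^sup>2)"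
  using \<epsilon> by (simp add: less_max_iff_disj)

lemma u_in_W0: "u \<in> W0_1p (real CARD('n)) B"
  unfolding moser_def[abs_def]
proof (rule radial_in_W0_1p[OF capped_log_has_derivative[OF \<epsilon>(1)]])
  show "continuous_on UNIV (\<lambda>s. 1 / (2 * max s (\<epsilon>\<^sup>2)))"
    using max_pos by (intro continuous_intros) (metis less_irrefl mult_eq_0_iff zero_neq_numeral)
  show "capped_log \<epsilon> 1 = 0"
  proof -
    have "\<epsilon>\<^sup>2 < 1" using \<epsilon> by (simp add: power_less_one_iff)
    then show ?thesis by (simp add: capped_log_def)
  qed
qed (use dim in simp)

lemma V_nonneg: "x \<in> B \<Longrightarrow> 0 \<le> V x"
  using u_pos[of x] dim \<epsilon> by (auto simp: moser_potential_def)

text \<open>On the cap \<open>|x| < \<epsilon>\<close> and \<open>u \<ge> - ln \<epsilon>\<close>;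
  the powers of \<open>\<epsilon>\<close> combine through \<open>2 (n - 1) = (n - 2) + n\<close>.
  The logarithmic factor is retained for the Orlicz bound.\<close>

lemma V_le: "V x \<le> 2 * (real CARD('n) - 1) / (\<epsilon> ^ CARD('n) * (- ln \<epsilon>) ^ (CARD('n) - 1))"
proof (cases "norm x < \<epsilon>")
  case True
  let ?n = "CARD('n)"
  have "2 * (?n - 1) = ?n - 2 + ?n" using dim by linarith
  then have eq: "\<epsilon>\<^sup>2 ^ (?n - 1) = \<epsilon> ^ (?n - 2) * \<epsilon> ^ ?n"
    by (simp only: power_mult[symmetric] power_add)
  have "V x \<le> 2 * (real ?n - 1) * \<epsilon> ^ (?n - 2) / (\<epsilon>\<^sup>2 ^ (?n - 1) * (- ln \<epsilon>) ^ (?n - 1))"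
    using True dim \<epsilon> u_ge[of x] ln_\<epsilon> unfolding moser_potential_def
    by (auto intro!: frac_le mult_left_mono power_mono mult_pos_pos)
  also have "\<dots> = 2 * (real ?n - 1) / (\<epsilon> ^ ?n * (- ln \<epsilon>) ^ (?n - 1))"
    using \<epsilon> unfolding eq by simp
  finally show ?thesis .
next
  case False
  then show ?thesis using dim \<epsilon> ln_\<epsilon> by (simp add: moser_potential_def)
qed

lemma V_measurable: "V \<in> borel_measurable (lebesgue_on \<Omega>)"
proof -
  have [measurable]: "u \<in> borel_measurable borel"
    by (rule borel_measurable_continuous_onI[OF u_continuous])
  have "V \<in> borel_measurable borel"
    unfolding moser_potential_def[abs_def] by measurable
  then show ?thesis
    by (intro measurable_restrict_space1 measurable_completion) simp
qed

text \<open>Both sides of the weak equation are recognised as the two integrals of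
  \<open>radial_field_weak_divergence\<close>, with \<open>\<epsilon>\<close> as the only
  exceptional radius.\<close>

lemma weak_solution_u: "weak_solution B V u"
proof -
  let ?n = "CARD('n)"
  define G where "G x = (- (1 / max ((norm x)\<^sup>2) (\<epsilon>\<^sup>2))) *\<^sub>R x" for x :: "real^'n"
  \<comment> \<open>The coefficient for which \<open>|G|^(n-2) G = - h(|x|) x\<close>.\<close>
  define h where "h r = r ^ (?n - 2) * (1 / max (r\<^sup>2) (\<epsilon>\<^sup>2)) ^ (?n - 1)" for r :: real
  \<comment> \<open>The quotient \<open>r ^ (n - 2) / r\<close> avoids the exponent
    \<open>n - 3\<close>, which truncated subtraction would spoil for \<open>n = 2\<close>.\<close>
  define h' where "h' r = (if r < \<epsilon> then (real ?n - 2) * (r ^ (?n - 2) / r) / \<epsilon>\<^sup>2 ^ (?n - 1)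
      else - real ?n / r ^ Suc ?n)" for r :: real
  have cG: "continuous_on UNIV G"
    unfolding G_def[abs_def] using max_pos
    by (intro continuous_intros) (metis less_irrefl)
  have wg: "weak_gradient B u G"
  proof (rule weak_gradient_C1[OF _ cG])
    show "(u has_derivative (\<lambda>v. G x \<bullet> v)) (at x)" for x
      unfolding G_def by (rule u_has_derivative)
  qed simp
  have lip_pow: "lipschitz_on_balls (\<lambda>r::real. f r ^ m)" if "lipschitz_on_balls f" for f m
  proof (induction m)
    case 0
    show ?case unfolding lipschitz_on_balls_def power_0
      by (intro allI exI[of _ 0] lipschitz_on_constant)
  next
    case (Suc m)
    then show ?case using lipschitz_on_balls_mult[OF that] by simp
  qed
  have lip_id: "lipschitz_on_balls (\<lambda>r::real. r)"
    unfolding lipschitz_on_balls_def using lipschitz_on_id by blast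
  have lip_m: "lipschitz_on_balls (\<lambda>r::real. 1 / max (r\<^sup>2) (\<epsilon>\<^sup>2))"
    unfolding lipschitz_on_balls_def
  proof
    fix b
    obtain L where L: "L-lipschitz_on (cball 0 b) (\<lambda>r::real. r\<^sup>2)"
      using lip_pow[OF lip_id] unfolding lipschitz_on_balls_def by blast
    have "(L / \<epsilon> ^ 4)-lipschitz_on (cball 0 b) (\<lambda>r::real. 1 / max (r\<^sup>2) (\<epsilon>\<^sup>2))"
    proof (rule lipschitz_onI)
      fix r s :: real assume rs: "r \<in> cball 0 b" "s \<in> cball 0 b"
      let ?R = "max (r\<^sup>2) (\<epsilon>\<^sup>2)" and ?S = "max (s\<^sup>2) (\<epsilon>\<^sup>2)"
      have "1 / ?R - 1 / ?S = (?S - ?R) / (?R * ?S)"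
        using max_pos[of "r\<^sup>2"] max_pos[of "s\<^sup>2"] by (simp add: field_simps)
      then have "\<bar>1 / ?R - 1 / ?S\<bar> = \<bar>?S - ?R\<bar> / (?R * ?S)"
        using max_pos[of "r\<^sup>2"] max_pos[of "s\<^sup>2"] by (simp add: abs_mult)
      also have "\<dots> \<le> (L * dist r s) / (\<epsilon>\<^sup>2 * \<epsilon>\<^sup>2)"
      proof (rule frac_le)
        have "\<bar>?S - ?R\<bar> \<le> \<bar>r\<^sup>2 - s\<^sup>2\<bar>" by linarith
        then show "\<bar>?S - ?R\<bar> \<le> L * dist r s"
          using lipschitz_onD[OF L rs] by (simp add: dist_real_def)
        show "\<epsilon>\<^sup>2 * \<epsilon>\<^sup>2 \<le> ?R * ?S" by (intro mult_mono) (auto simp: le_max_iff_disj)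
      qed (use \<epsilon> lipschitz_on_nonneg[OF L] in auto)
      finally show "dist (1 / ?R) (1 / ?S) \<le> L / \<epsilon> ^ 4 * dist r s"
        by (simp add: dist_real_def power4_eq_xxxx power2_eq_square mult.assoc)
    qed (use \<epsilon> lipschitz_on_nonneg[OF L] in simp)
    then show "\<exists>L. L-lipschitz_on (cball 0 b) (\<lambda>r::real. 1 / max (r\<^sup>2) (\<epsilon>\<^sup>2))" by blast
  qed
  have lip_h: "lipschitz_on_balls h"
    unfolding h_def[abs_def] by (intro lipschitz_on_balls_mult lip_pow lip_id lip_m)
  \<comment> \<open>With this profile the field is divergence free: \<open>n h = n / r^n\<close>
    cancels against \<open>r h'\<close>.\<close>
  have outer: "h r = 1 / r ^ ?n" if "\<epsilon> \<le> r" for r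
  proof -
    have "\<epsilon>\<^sup>2 \<le> r\<^sup>2" using that \<epsilon> by (intro power_mono) auto
    then have m: "max (r\<^sup>2) (\<epsilon>\<^sup>2) = r\<^sup>2" by (rule max_absorb1)
    have "2 * (?n - 1) = ?n - 2 + ?n" using dim by linarith
    then have e: "r\<^sup>2 ^ (?n - 1) = r ^ (?n - 2) * r ^ ?n"
      by (simp only: power_mult[symmetric] power_add)
    show ?thesis
      unfolding h_def m power_one_over e using that \<epsilon> by simp
  qed
  have inner: "h r = r ^ (?n - 2) / \<epsilon>\<^sup>2 ^ (?n - 1)" if "0 \<le> r" "r < \<epsilon>" for r
  proof -
    have "r\<^sup>2 \<le> \<epsilon>\<^sup>2" using that by (intro power_mono) auto
    then show ?thesis by (simp add: h_def max_def power_one_over)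
  qed
  have dh: "(h has_real_derivative h' r) (at r)" if r: "0 < r" "r \<notin> {\<epsilon>}" for r
  proof (cases "r < \<epsilon>")
    case True
    have "((\<lambda>r. r ^ (?n - 2) / \<epsilon>\<^sup>2 ^ (?n - 1)) has_real_derivative h' r) (at r)"
    proof (cases "?n - 2")
      case 0
      then have "?n = 2" using dim by simp
      then show ?thesis using True by (simp add: h'_def)
    next
      case (Suc k)
      then have n: "real ?n - 2 = real k + 1" using dim by linarith
      have "((\<lambda>r. r ^ Suc k / \<epsilon>\<^sup>2 ^ (?n - 1)) has_real_derivative
          real (Suc k) * r ^ (Suc k - Suc 0) / \<epsilon>\<^sup>2 ^ (?n - 1)) (at r)"
        by (intro DERIV_cdivide DERIV_pow)
      then show ?thesis unfolding Suc
        by (rule DERIV_cong) (use True r in \<open>simp add: h'_def n Suc\<close>)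
    qed
    then show ?thesis
      by (rule has_field_derivative_transform_within_open[where S="{0<..<\<epsilon>}"])
        (use r True inner in auto)
  next
    case False
    have "((\<lambda>r. 1 / r ^ ?n) has_real_derivative h' r) (at r)"
    proof -
      have "((\<lambda>r. inverse (r ^ ?n)) has_real_derivative
          - (inverse (r ^ ?n) * (real ?n * r ^ (?n - Suc 0)) * inverse (r ^ ?n))) (at r)"
        by (rule DERIV_inverse'[OF DERIV_pow]) (use r in simp)
      moreover have "- (inverse (r ^ ?n) * (real ?n * r ^ (?n - Suc 0)) * inverse (r ^ ?n)) = h' r"
      proof -
        have "r ^ ?n = r ^ (?n - Suc 0) * r"
          using power_minus_mult[of ?n r] by simp
        then show ?thesis
          using False r by (simp add: h'_def divide_inverse)
      qed
      ultimately show ?thesis by (simp add: inverse_eq_divide)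
    qed
    then show ?thesis
      by (rule has_field_derivative_transform_within_open[where S="{\<epsilon><..}"])
        (use r False outer in auto)
  qed
  have mh': "h' \<in> borel_measurable borel"
    unfolding h'_def[abs_def] by measurable
  have flux: "norm (G x) ^ (?n - 2) * (G x \<bullet> y) = - (h (norm x) * (x \<bullet> y))" for x y
  proof -
    let ?m = "1 / max ((norm x)\<^sup>2) (\<epsilon>\<^sup>2)"
    have m: "0 \<le> ?m" using max_pos[of "(norm x)\<^sup>2"] by simp
    have "norm (G x) = ?m * norm x" unfolding G_def using m by simp
    moreover have "G x \<bullet> y = - (?m * (x \<bullet> y))" by (simp add: G_def)
    moreover have "?n - 1 = Suc (?n - 2)" using dim by linarith
    then have "?m ^ (?n - 1) = ?m * ?m ^ (?n - 2)" by (simp only: power_Suc)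
    ultimately show ?thesis
      by (simp only: h_def power_mult_distrib) (simp only: mult_ac mult_minus_left mult_minus_right)
  qed
  have source: "V x * u x ^ (?n - 1) * t = (real ?n * h (norm x) + norm x * h' (norm x)) * t"
    if "norm x \<noteq> \<epsilon>" for x :: "real^'n" and t
  proof (cases "norm x < \<epsilon>")
    case True
    have u0: "u x \<noteq> 0" using u_pos[of x] True \<epsilon> by auto
    have "norm x * h' (norm x) = (real ?n - 2) * norm x ^ (?n - 2) / \<epsilon>\<^sup>2 ^ (?n - 1)"
    \<comment> \<open>At the origin the left side vanishes by its factor \<open>norm x\<close>; on
      the right either \<open>n - 2 = 0\<close> or a positive power of 0 occurs.\<close>
    proof (cases "x = 0")
      case True
      then have "(real ?n - 2) * norm x ^ (?n - 2) = 0"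
        using dim by (cases "?n = 2") auto
      then show ?thesis using True by simp
    next
      case False
      then show ?thesis using True by (simp add: h'_def)
    qed
    moreover have "h (norm x) = norm x ^ (?n - 2) / \<epsilon>\<^sup>2 ^ (?n - 1)"
      using inner True by simp
    moreover have "V x * u x ^ (?n - 1) = 2 * (real ?n - 1) * norm x ^ (?n - 2) / \<epsilon>\<^sup>2 ^ (?n - 1)"
      using True u0 by (simp add: moser_potential_def)
    ultimately show ?thesis
      by (simp add: diff_divide_distrib[symmetric] add_divide_distrib[symmetric] algebra_simps)
  next
    case False
    then have "\<epsilon> < norm x" using that by simp
    then show ?thesis using outer[of "norm x"] \<epsilon>
      by (auto simp: moser_potential_def h'_def)
  qed
  have AE_source: "AE x in lebesgue. V x * u x ^ (?n - 1) * \<phi> x = (real ?n * h (norm x) + norm x * h' (norm x)) * \<phi> x" for \<phi>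
  proof -
    have "sphere (0::real^'n) \<epsilon> \<in> null_sets lebesgue"
      using negligible_convex_frontier[of "cball 0 \<epsilon> :: (real^'n) set"]
      by (simp add: negligible_iff_null_sets)
    then have "AE x in lebesgue. x \<notin> sphere (0::real^'n) \<epsilon>"
      by (rule AE_not_in)
    then show ?thesis
      by (rule eventually_mono) (rule source, simp)
  qed
  show ?thesis
    unfolding weak_solution_def
  proof (intro exI[of _ G] conjI ballI wg)
    fix \<phi> assume \<phi>: "\<phi> \<in> test_functions B"
    have "finite {\<epsilon>}" by simp
    note rd = radial_field_weak_divergence[OF \<phi> lip_h this dh mh']
    note zero = test_function_zero[OF \<phi>]
    have mV: "(\<lambda>x. V x * u x ^ (?n - 1) * \<phi> x) \<in> borel_measurable lebesgue"
    proof -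
      have "continuous_on UNIV \<phi>"
        using \<phi> Ck_imp_continuous by (auto simp: test_functions_def)
      from borel_measurable_lebesgue_on_continuous[OF this, of UNIV]
        borel_measurable_lebesgue_on_continuous[OF u_continuous, of UNIV] V_measurable[of UNIV]
      show ?thesis
        unfolding lebesgue_on_UNIV_eq by (intro borel_measurable_times borel_measurable_power)
    qed
    have cong: "integral\<^sup>L lebesgue (\<lambda>x. V x * u x ^ (?n - 1) * \<phi> x)
        = integral\<^sup>L lebesgue (\<lambda>x. (real ?n * h (norm x) + norm x * h' (norm x)) * \<phi> x)"
      by (rule integral_cong_AE[OF mV _ AE_source]) (rule borel_measurable_integrable[OF rd(2)])
    have icong: "integrable lebesgue (\<lambda>x. V x * u x ^ (?n - 1) * \<phi> x)"
      by (rule integrable_cong_AE_imp[OF rd(2) mV]) (use AE_source[of \<phi>] in \<open>auto elim: eventually_mono\<close>)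
    show "integrable (lebesgue_on B) (\<lambda>x. norm (G x) ^ (?n - 2) * (G x \<bullet> grad \<phi> x))"
      by (subst integral_lebesgue_on_eq(2)) (use rd(1) in \<open>auto simp: flux zero\<close>)
    show "integrable (lebesgue_on B) (\<lambda>x. V x * u x ^ (?n - 1) * \<phi> x)"
      by (subst integral_lebesgue_on_eq(2)) (use icong in \<open>auto simp: zero\<close>)
    show "integral\<^sup>L (lebesgue_on B) (\<lambda>x. norm (G x) ^ (?n - 2) * (G x \<bullet> grad \<phi> x)) =
        integral\<^sup>L (lebesgue_on B) (\<lambda>x. V x * u x ^ (?n - 1) * \<phi> x)"
      by (subst (1 2) integral_lebesgue_on_eq(1)) (use rd(3) in \<open>auto simp: flux zero cong[unfolded One_nat_def]\<close>)
  qed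
qed

lemma positive_solution: "positive_W0_solution V u"
  unfolding positive_W0_solution_def
  using u_in_W0 u_pos V_measurable V_nonneg weak_solution_u by blast

end

section \<open>Norms of the Moser functions\<close>

context moser_family
begin

text \<open>Discards the logarithmic factor, which is at least 1. For the \<open>L^1\<close> bound
  the height \<open>\<epsilon>^-n\<close> against the volume of order \<open>\<epsilon>^n\<close>
  already suffices.\<close>

lemma V_bounded:
  assumes "x \<in> B"
  shows "\<bar>V x\<bar> \<le> 2 * (real CARD('n) - 1) / \<epsilon> ^ CARD('n) * indicator (ball 0 \<epsilon>) x"
proof (cases "norm x < \<epsilon>")
  case True
  have "1 \<le> (- ln \<epsilon>) ^ (CARD('n) - 1)" using ln_\<epsilon> by (rule one_le_power)
  then have "\<epsilon> ^ CARD('n) * 1 \<le> \<epsilon> ^ CARD('n) * (- ln \<epsilon>) ^ (CARD('n) - 1)"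
    using \<epsilon> by (intro mult_left_mono) auto
  then have "2 * (real CARD('n) - 1) / (\<epsilon> ^ CARD('n) * (- ln \<epsilon>) ^ (CARD('n) - 1))
      \<le> 2 * (real CARD('n) - 1) / \<epsilon> ^ CARD('n)"
    using dim \<epsilon> by (intro frac_le) auto
  then show ?thesis
    using V_le[of x] V_nonneg[OF assms] True by simp
qed (simp add: moser_potential_def)

lemma V_abs_le:
  assumes "x \<in> B"
  shows "\<bar>V x\<bar> \<le> 2 * (real CARD('n) - 1) / \<epsilon> ^ CARD('n)"
proof (cases "norm x < \<epsilon>")
  case True
  then show ?thesis using V_bounded[OF assms] by simp
next
  case False
  then show ?thesis using dim \<epsilon> by (simp add: moser_potential_def)
qed

text \<open>With \<open>v\<close> the height of the potential before division by
  \<open>L^(n-1)\<close>, the logarithm \<open>ln (v + 1)\<close> is at most \<open>D L\<close>. Its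
  power at most \<open>n - 1\<close> is compensated by the \<open>L^(n-1)\<close> in the
  denominator, and the volume of the cap cancels \<open>\<epsilon>^-n\<close>. The resulting
  \<open>M\<close> is independent of \<open>\<epsilon>\<close> and even of \<open>r\<close>.\<close>

lemma N_norm_V_le:
  assumes r: "1 \<le> r"
  shows "N_norm r B V \<le> ereal (max 1 (2 * (real CARD('n) - 1) *
    (ln (2 * real CARD('n)) + real CARD('n)) ^ (CARD('n) - 1) * measure lborel B))"
proof -
  define n where "n = CARD('n)"
  define L where "L = - ln \<epsilon>"
  define D where "D = ln (2 * real n) + real n"
  define v where "v = 2 * (real n - 1) / \<epsilon> ^ n"
  define M where "M = max 1 (2 * (real n - 1) * D ^ (n - 1) * measure lborel B)"
  define a where "a = (real n - 1) / r"
  have n: "2 \<le> n" using dim by (simp add: n_def)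
  have L: "1 \<le> L" using ln_\<epsilon> by (simp add: L_def)
  have M: "1 \<le> M" by (simp add: M_def)
  have v0: "0 \<le> v" using n \<epsilon> by (simp add: v_def)
  have a: "0 < a" "a \<le> real n - 1"
    using r n divide_left_mono[of 1 r "real n - 1"] by (auto simp: a_def)
  have lnn: "0 \<le> ln (2 * real n)" using n by simp
  have "2 \<le> real n" using n by simp
  then have D: "1 \<le> D" using lnn unfolding D_def by linarith
  have DL: "1 \<le> D * L" using D L mult_mono[of 1 D 1 L] by simp
  have v1: "ln (v + 1) \<le> D * L"
  proof -
    have "\<epsilon> ^ n \<le> 1" using \<epsilon> by (intro power_le_one) auto
    then have "v + 1 \<le> 2 * real n / \<epsilon> ^ n"
      using \<epsilon> by (simp add: v_def field_simps)
    then have "ln (v + 1) \<le> ln (2 * real n / \<epsilon> ^ n)"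
      using v0 by (intro ln_mono) auto
    also have "\<dots> = ln (2 * real n) * 1 + real n * L"
      using n \<epsilon> by (simp add: ln_div ln_realpow L_def)
    also have "\<dots> \<le> ln (2 * real n) * L + real n * L"
      using lnn L by (intro add_mono mult_left_mono) auto
    finally show ?thesis by (simp add: D_def algebra_simps)
  qed
  have pw: "N_fun n r (\<bar>V x\<bar> / M) \<le> v * D ^ (n - 1) / M" if x: "x \<in> B" for x
  proof -
    define t where "t = \<bar>V x\<bar> / M"
    have t0: "0 \<le> t" using M by (simp add: t_def)
    have t: "t \<le> v / L ^ (n - 1) / M"
      unfolding t_def using V_le[of x] V_nonneg[OF x] M
      by (intro divide_right_mono) (auto simp: v_def n_def L_def)
    have "v / L ^ (n - 1) / M \<le> v / 1 / 1"
      using v0 L M by (intro frac_le) (auto simp: one_le_power)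
    then have tv: "t \<le> v" using t by simp
    have "ln (t + 1) \<le> ln (v + 1)" using t0 tv by simp
    then have "ln (t + 1) powr a \<le> (D * L) powr a"
      using v1 t0 a by (intro powr_mono2) auto
    \<comment> \<open>Since \<open>D * L \<ge> 1\<close>, the exponent may be raised to
      \<open>n - 1\<close>, the value attained at \<open>r = 1\<close>; then the powers of
      \<open>L\<close> cancel exactly.\<close>
    also have "\<dots> \<le> (D * L) powr (real n - 1)"
      using DL a by (intro powr_mono) auto
    also have "\<dots> = (D * L) ^ (n - 1)"
      using DL n by (subst powr_realpow[symmetric]) (auto simp: of_nat_diff)
    finally have ln: "ln (t + 1) powr a \<le> (D * L) ^ (n - 1)" .
    have "N_fun n r t \<le> t * ln (t + 1) powr a"
      unfolding a_def using n r t0 by (intro N_fun_le) auto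
    also have "\<dots> \<le> (v / L ^ (n - 1) / M) * (D * L) ^ (n - 1)"
      using t t0 ln v0 L M by (intro mult_mono) auto
    also have "\<dots> = v * D ^ (n - 1) / M"
      using L by (simp add: power_mult_distrib)
    finally show ?thesis by (simp add: t_def)
  qed
  have c0: "0 \<le> v * D ^ (n - 1) / M" using v0 D M by simp
  have ptw: "ennreal (N_fun n r (\<bar>V x\<bar> / M)) * indicator B x
      \<le> ennreal (v * D ^ (n - 1) / M) * indicator (ball 0 \<epsilon>) x" for x
  proof (cases "x \<in> B \<and> norm x < \<epsilon>")
    case True
    then show ?thesis using pw[of x] by (auto intro: ennreal_leI)
  next
    case False
    have "N_fun n r 0 = 0" by (simp add: N_fun_def)
    then show ?thesis using False by (auto simp: moser_potential_def indicator_def)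
  qed
  have "(\<integral>\<^sup>+x. ennreal (N_fun n r (\<bar>V x\<bar> / M)) \<partial>lebesgue_on B)
      = (\<integral>\<^sup>+x. ennreal (N_fun n r (\<bar>V x\<bar> / M)) * indicator B x \<partial>lebesgue)"
    by (rule nn_integral_restrict_space) auto
  also have "\<dots> \<le> (\<integral>\<^sup>+x. ennreal (v * D ^ (n - 1) / M) * indicator (ball (0::real^'n) \<epsilon>) x \<partial>lebesgue)"
    by (rule nn_integral_mono) (rule ptw)
  also have "\<dots> = ennreal (v * D ^ (n - 1) / M) * ennreal (\<epsilon> ^ n * measure lborel B)"
    using \<epsilon> by (subst nn_integral_cmult_indicator) (auto simp: emeasure_lborel_ball n_def)
  also have "\<dots> = ennreal (2 * (real n - 1) * D ^ (n - 1) * measure lborel B / M)"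
    using c0 \<epsilon> by (subst ennreal_mult[symmetric]) (auto simp: v_def mult.assoc)
  also have "\<dots> \<le> 1"
  proof -
    have "2 * (real n - 1) * D ^ (n - 1) * measure lborel B \<le> M" by (simp add: M_def)
    then show ?thesis using M by simp
  qed
  finally show ?thesis
    unfolding N_norm_def using M luxemburg_norm_le[where c=M and \<Phi>="N_fun n r" and v=V and \<Omega>=B]
    by (simp add: n_def M_def D_def)
qed

lemma V_in_LlogL:
  assumes "1 \<le> r"
  shows "V \<in> LlogL r B"
proof -
  interpret finite_measure "lebesgue_on B"
    by (rule finite_measure_lebesgue_on) simp
  let ?v = "2 * (real CARD('n) - 1) / \<epsilon> ^ CARD('n)" and ?a = "(real CARD('n) - 1) / r"
  have v: "\<bar>V x\<bar> \<le> ?v" if "x \<in> B" for x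
    using V_abs_le[OF that] .
  have "integrable (lebesgue_on B) (\<lambda>x. \<bar>V x\<bar> * ln (\<bar>V x\<bar> + 1) powr ?a)"
  proof (rule integrable_const_bound[where B="?v * ln (?v + 1) powr ?a"])
    show "AE x in lebesgue_on B. norm (\<bar>V x\<bar> * ln (\<bar>V x\<bar> + 1) powr ?a) \<le> ?v * ln (?v + 1) powr ?a"
    proof (rule AE_I2)
      fix x assume "x \<in> space (lebesgue_on B)"
      then have x: "\<bar>V x\<bar> \<le> ?v" using v by simp
      then have "ln (\<bar>V x\<bar> + 1) \<le> ln (?v + 1)" by simp
      then have "\<bar>V x\<bar> * ln (\<bar>V x\<bar> + 1) powr ?a \<le> ?v * ln (?v + 1) powr ?a"
        using x assms dim by (intro mult_mono powr_mono2) auto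
      then show "norm (\<bar>V x\<bar> * ln (\<bar>V x\<bar> + 1) powr ?a) \<le> ?v * ln (?v + 1) powr ?a"
        by (simp add: abs_mult)
    qed
    have [measurable]: "V \<in> borel_measurable (lebesgue_on B)" by (rule V_measurable)
    show "(\<lambda>x. \<bar>V x\<bar> * ln (\<bar>V x\<bar> + 1) powr ?a) \<in> borel_measurable (lebesgue_on B)"
      by measurable
  qed
  then show ?thesis
    by (simp add: LlogL_def V_measurable)
qed

lemma V_in_L1: "in_Lp 1 B V"
proof (rule in_Lp_bounded)
  show "norm (V x) \<le> 2 * (real CARD('n) - 1) / \<epsilon> ^ CARD('n)" if "x \<in> B" for x
    using V_abs_le[OF that] by simp
qed (auto simp: V_measurable)

lemma L1_norm_V_le: "Lp_norm 1 B V \<le> 2 * (real CARD('n) - 1) * measure lborel B"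
proof -
  let ?v = "2 * (real CARD('n) - 1) / \<epsilon> ^ CARD('n)"
  have I: "integrable (lebesgue_on B) (\<lambda>x. \<bar>V x\<bar>)"
    using V_in_L1 by (simp add: in_Lp_def)
  have sub: "ball 0 \<epsilon> \<subseteq> B" using \<epsilon> by auto
  have J: "integrable lebesgue (\<lambda>x. ?v * indicator (ball (0::real^'n) \<epsilon>) x)"
    using emeasure_bounded_finite[of "ball (0::real^'n) \<epsilon>"]
    by (intro integrable_mult_right integrable_real_indicator) auto
  have eq: "integral\<^sup>L (lebesgue_on B) (\<lambda>x. ?v * indicator (ball (0::real^'n) \<epsilon>) x)
      = integral\<^sup>L lebesgue (\<lambda>x. ?v * indicator (ball (0::real^'n) \<epsilon>) x)"
    and J': "integrable (lebesgue_on B) (\<lambda>x. ?v * indicator (ball (0::real^'n) \<epsilon>) x)"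
    using J sub by (subst integral_lebesgue_on_eq; auto simp: indicator_def)+
  have "integral\<^sup>L (lebesgue_on B) (\<lambda>x. \<bar>V x\<bar>)
      \<le> integral\<^sup>L (lebesgue_on B) (\<lambda>x. ?v * indicator (ball (0::real^'n) \<epsilon>) x)"
    by (rule integral_mono[OF I J']) (use V_bounded in simp)
  also have "\<dots> = ?v * measure lborel (ball (0::real^'n) \<epsilon>)"
    unfolding eq by simp
  also have "\<dots> = 2 * (real CARD('n) - 1) * measure lborel B"
    using \<epsilon> content_ball_conv_unit_ball[of \<epsilon> "0::real^'n"] by simp
  finally have "integral\<^sup>L (lebesgue_on B) (\<lambda>x. \<bar>V x\<bar>) \<le> 2 * (real CARD('n) - 1) * measure lborel B" .
  then show ?thesis
    by (simp add: Lp_norm_def)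
qed

lemma ball_not_null: "0 < r \<Longrightarrow> emeasure lebesgue (ball (x::real^'n) r) \<noteq> 0"
  by (simp add: emeasure_lborel_ball)

lemma ess_sup_u:
  assumes "\<epsilon> \<le> \<rho>" "\<rho> \<le> 1"
  shows "ereal (- ln \<epsilon>) \<le> ess_sup (ball 0 \<rho>) u" "ess_sup (ball 0 \<rho>) u < \<infinity>"
    "Linf_norm (ball 0 \<rho>) u = ess_sup (ball 0 \<rho>) u"
proof -
  have sub: "ball (0::real^'n) \<rho> \<subseteq> B" using assms by auto
  show "ereal (- ln \<epsilon>) \<le> ess_sup (ball 0 \<rho>) u"
    by (rule ess_sup_ge[where A="ball 0 \<epsilon>"])
      (use assms \<epsilon> ball_not_null u_ge in auto)
  have "ess_sup (ball 0 \<rho>) u \<le> ereal (- ln \<epsilon> + 1/2)"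
    by (rule ess_sup_le) (rule borel_measurable_lebesgue_on_continuous[OF u_continuous], rule u_le)
  then show "ess_sup (ball 0 \<rho>) u < \<infinity>"
    by (rule le_less_trans) simp
  have "\<bar>u x\<bar> = u x" if "x \<in> ball 0 \<rho>" for x
    using u_pos[of x] sub that by auto
  then have "AE x in lebesgue_on (ball 0 \<rho>). ereal \<bar>u x\<bar> = ereal (u x)"
    by (intro AE_I2) auto
  then show "Linf_norm (ball 0 \<rho>) u = ess_sup (ball 0 \<rho>) u"
    unfolding Linf_norm_def ess_sup_def
    by (intro esssup_AE_cong borel_measurable_ereal borel_measurable_abs
        borel_measurable_lebesgue_on_continuous u_continuous)
qed

lemma ess_inf_u:
  "0 < ess_inf (ball 0 (1/8)) u" "ess_inf (ball 0 (1/8)) u \<le> ereal (ln 16)"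
proof -
  have "ess_sup (ball 0 (1/8)) (\<lambda>x. - u x) \<le> ereal (- ln 8)"
    by (rule ess_sup_le)
      (use u_ge_8 in \<open>auto intro!: borel_measurable_uminus borel_measurable_lebesgue_on_continuous u_continuous\<close>)
  then have "- ereal (- ln 8) \<le> ess_inf (ball 0 (1/8)) u"
    unfolding ess_inf_eq_ess_sup by (simp only: ereal_minus_le_minus)
  then have "ereal (ln 8) \<le> ess_inf (ball 0 (1/8)) u" by simp
  then show "0 < ess_inf (ball 0 (1/8)) u"
    by (rule less_le_trans[rotated]) simp
  \<comment> \<open>The radius \<open>3/32\<close> is midway between \<open>1/16\<close> and
    \<open>1/8\<close>, so the ball of radius \<open>1/32\<close> around \<open>y\<close> stays in
    that annulus. Its positive measure bounds the essential infimum from above.\<close>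
  obtain y :: "real^'n" where y: "norm y = 3/32"
    using vector_choose_size[of "3/32"] by auto
  have near: "1/16 \<le> norm x \<and> norm x < 1/8" if "x \<in> ball y (1/32)" for x
    using that y norm_triangle_ineq2[of x y] norm_triangle_ineq2[of y x]
    by (auto simp: dist_norm norm_minus_commute)
  have "ereal (- ln 16) \<le> ess_sup (ball 0 (1/8)) (\<lambda>x. - u x)"
  proof (rule ess_sup_ge[where A="ball y (1/32)"])
    show "ereal (- ln 16) \<le> ereal (- u x)" if "x \<in> ball y (1/32)" for x
    proof -
      have "x \<noteq> 0" using near[OF that] by auto
      then have "u x \<le> - ln (norm x)" by (rule u_le_log)
      also have "\<dots> \<le> - ln (1/16)"
        using near[OF that] ln_mono[of "1/16" "norm x"] by simp
      also have "\<dots> = ln 16" by (simp add: ln_div)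
      finally show ?thesis by simp
    qed
  qed (use near ball_not_null in auto)
  then have "ess_inf (ball 0 (1/8)) u \<le> - ereal (- ln 16)"
    unfolding ess_inf_eq_ess_sup by (simp only: ereal_minus_le_minus)
  then show "ess_inf (ball 0 (1/8)) u \<le> ereal (ln 16)" by simp
qed

lemma E_norm_u:
  assumes r: "1 \<le> r"
  defines "q \<equiv> r * real CARD('n) / (real CARD('n) - 1)"
  shows "0 < E_norm (r * real CARD('n)) B u"
    and "E_norm (r * real CARD('n)) B u \<le> ereal ((max 1 (4 * measure lborel B) * (2 * - ln \<epsilon>) powr (q - 1)) powr (1 / q))"
proof -
  have "real CARD('n) - 1 \<le> 1 * real CARD('n)" by simp
  also have "\<dots> \<le> r * real CARD('n)" using r by (intro mult_right_mono) auto
  finally have q: "1 \<le> q" using dim by (simp add: q_def)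
  have E: "E_norm (r * real CARD('n)) B u = luxemburg_norm (\<lambda>t. exp (t powr q) - 1) B u"
    by (simp add: E_norm_def q_def)
  have "1 \<le> ln (8::real)"
    using ln_mono[of "exp 1" "8::real"] e_less_272 by simp
  then show "0 < E_norm (r * real CARD('n)) B u"
    unfolding E using q u_ge_8
    by (intro luxemburg_norm_exp_pos[where r="1/8"]) (auto intro: order_trans)
  show "E_norm (r * real CARD('n)) B u \<le> ereal ((max 1 (4 * measure lborel B) * (2 * - ln \<epsilon>) powr (q - 1)) powr (1 / q))"
    unfolding E
  proof (rule luxemburg_norm_exp_le[OF _ q])
    \<comment> \<open>The cap adds at most \<open>1/2\<close> to \<open>- ln \<epsilon>\<close>, and
      \<open>- ln \<epsilon> \<ge> 1\<close>.\<close>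
    show "u x \<le> 2 * - ln \<epsilon>" for x using u_le[of x] ln_\<epsilon> by linarith
  qed (use dim ln_\<epsilon> u_pos u_le_log in \<open>auto intro: less_imp_le\<close>)
qed

text \<open>The numerator is at least \<open>L\<close> and the norm at most a constant times
  \<open>L^((q-1)/q)\<close>, which leaves \<open>L^(1/q)\<close>.\<close>

lemma ratio_ge:
  assumes r: "1 \<le> r"
  defines "q \<equiv> r * real CARD('n) / (real CARD('n) - 1)"
  shows "ereal ((1 / (max 1 (4 * measure lborel B) * 2 powr (q - 1)) powr (1 / q)) * (- ln \<epsilon>) powr (1 / q))
    \<le> Linf_norm (ball 0 (1/2)) u / E_norm (r * real CARD('n)) B u"
proof -
  let ?E = "E_norm (r * real CARD('n)) B u"
  define L where "L = - ln \<epsilon>"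
  define K where "K = max 1 (4 * measure lborel B)"
  have K: "1 \<le> K" by (simp add: K_def)
  have L: "1 \<le> L" using ln_\<epsilon> by (simp add: L_def)
  have "0 < r * real CARD('n)" using r by simp
  then have q: "0 < q" using dim by (simp add: q_def)
  define l where "l = (K * (2 * L) powr (q - 1)) powr (1 / q)"
  have l0: "0 < l" using K L by (simp add: l_def)
  have E: "0 < ?E" "?E \<le> ereal l"
    using E_norm_u[OF r] by (simp_all add: l_def L_def K_def q_def)
  have sup: "ereal L \<le> Linf_norm (ball 0 (1/2)) u"
    using ess_sup_u[of "1/2"] \<epsilon> by (simp add: L_def)
  have "(1 / (K * 2 powr (q - 1)) powr (1 / q)) * L powr (1 / q) = L / l"
  proof -
    have "l = (K * 2 powr (q - 1) * L powr (q - 1)) powr (1 / q)"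
      using L by (simp add: l_def powr_mult mult.assoc)
    also have "\<dots> = (K * 2 powr (q - 1)) powr (1 / q) * L powr ((q - 1) / q)"
      using K L by (simp add: powr_mult powr_powr)
    also have "(q - 1) / q = 1 - 1 / q"
      using q by (simp add: diff_divide_distrib)
    finally have "l = (K * 2 powr (q - 1)) powr (1 / q) * (L / L powr (1 / q))"
      using L by (simp add: powr_diff)
    then show ?thesis using K L by simp
  qed
  then have "ereal ((1 / (K * 2 powr (q - 1)) powr (1 / q)) * L powr (1 / q)) = ereal L / ereal l"
    using l0 by simp
  also have "\<dots> \<le> ereal L / ?E"
  proof -
    obtain e where e: "?E = ereal e" "0 < e" "e \<le> l"
      using E by (cases ?E) auto
    then show ?thesis using L l0 by (simp add: frac_le)
  qed
  also have "\<dots> \<le> Linf_norm (ball 0 (1/2)) u / ?E"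
    using sup E by (intro ereal_divide_right_mono) auto
  finally show ?thesis by (simp add: K_def L_def)
qed

end

section \<open>Divergence of the ratios and failure of monotone constants\<close>

lemma tendsto_PInfty_lower_bound:
  fixes f :: "'a \<Rightarrow> ereal"
  assumes "filterlim g at_top F" "\<forall>\<^sub>F x in F. ereal (g x) \<le> f x"
  shows "(f \<longlongrightarrow> \<infinity>) F"
proof (rule tendsto_sandwich[OF assms(2)])
  show "((\<lambda>x. ereal (g x)) \<longlongrightarrow> \<infinity>) F"
    using assms(1) by (simp add: tendsto_PInfty_eq_at_top)
qed auto

lemma not_eventually_le_mult:
  fixes S I :: "'a \<Rightarrow> ereal"
  assumes lim: "((\<lambda>x. S x / I x) \<longlongrightarrow> \<infinity>) F" and F: "F \<noteq> bot"
    and I: "\<forall>\<^sub>F x in F. 0 < I x \<and> I x < \<infinity>"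
  shows "\<not> (\<forall>\<^sub>F x in F. S x \<le> ereal c * I x)"
proof
  assume "\<forall>\<^sub>F x in F. S x \<le> ereal c * I x"
  moreover have "\<forall>\<^sub>F x in F. ereal c < S x / I x"
    using order_tendstoD(1)[OF lim, of "ereal c"] by simp
  ultimately have "\<forall>\<^sub>F x in F. False"
    using I
  proof eventually_elim
    case (elim x)
    then have "S x / I x \<le> ereal c"
      by (subst ereal_divide_le_pos) (auto simp: mult.commute)
    then show False using elim by simp
  qed
  then show False using F by simp
qed

text \<open>Monotonicity freezes the constant: along the family \<open>C (b x)\<close> is at most
  \<open>C M\<close>, and a fixed constant contradicts the unbounded ratio.\<close>

lemma not_monotone_bound:
  fixes S I :: "'a \<Rightarrow> ereal" and b :: "'a \<Rightarrow> real"
  assumes lim: "((\<lambda>x. S x / I x) \<longlongrightarrow> \<infinity>) F" and F: "F \<noteq> bot"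
    and I: "\<forall>\<^sub>F x in F. 0 < I x \<and> I x < \<infinity>"
    and N: "\<forall>\<^sub>F x in F. 0 \<le> b x \<and> b x \<le> M" and C: "mono_on {0..} C"
  shows "\<not> (\<forall>\<^sub>F x in F. S x \<le> ereal (C (b x)) * I x)"
proof
  assume "\<forall>\<^sub>F x in F. S x \<le> ereal (C (b x)) * I x"
  then have "\<forall>\<^sub>F x in F. S x \<le> ereal (C M) * I x"
    using N I
  proof eventually_elim
    case (elim x)
    have "C (b x) \<le> C M"
      using elim order_trans[of 0 "b x" M] by (intro mono_onD[OF C]) auto
    then have "ereal (C (b x)) * I x \<le> ereal (C M) * I x"
      using elim by (intro ereal_mult_right_mono) auto
    then show ?case using elim by (meson order_trans)
  qed
  then show False
    using not_eventually_le_mult[OF lim F I] by blast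
qed

theorem mainTheorem3:
  assumes "2 \<le> CARD('n::finite)"
  shows
    "(\<exists>(\<epsilon>\<^sub>0::real) (u :: real \<Rightarrow> real ^ 'n \<Rightarrow> real) (V :: real \<Rightarrow> real ^ 'n \<Rightarrow> real).
        0 < \<epsilon>\<^sub>0 \<and> \<epsilon>\<^sub>0 \<le> 1/8 \<and>
        (\<forall>\<epsilon>. 0 < \<epsilon> \<and> \<epsilon> < \<epsilon>\<^sub>0 \<longrightarrow> positive_W0_solution (V \<epsilon>) (u \<epsilon>)) \<and>
        (\<forall>r::real. 1 \<le> r \<longrightarrow>
           (\<forall>\<epsilon>. 0 < \<epsilon> \<and> \<epsilon> < \<epsilon>\<^sub>0 \<longrightarrow> V \<epsilon> \<in> LlogL r (ball 0 1)) \<and>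
           (\<exists>M::real. \<forall>\<^sub>F \<epsilon> in at_right 0. N_norm r (ball 0 1) (V \<epsilon>) \<le> ereal M)) \<and>
        (\<forall>\<epsilon>. 0 < \<epsilon> \<and> \<epsilon> < \<epsilon>\<^sub>0 \<longrightarrow> in_Lp 1 (ball 0 1) (V \<epsilon>)) \<and>
        (\<exists>M::real. \<forall>\<^sub>F \<epsilon> in at_right 0. Lp_norm 1 (ball 0 1) (V \<epsilon>) \<le> M) \<and>
        (\<forall>r::real. 1 \<le> r \<longrightarrow>
           (\<forall>\<epsilon>. 0 < \<epsilon> \<and> \<epsilon> < \<epsilon>\<^sub>0 \<longrightarrow>
              Linf_norm (ball 0 (1/2)) (u \<epsilon>) < \<infinity> \<and>
              0 < E_norm (r * real CARD('n)) (ball 0 1) (u \<epsilon>) \<and>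
              E_norm (r * real CARD('n)) (ball 0 1) (u \<epsilon>) < \<infinity>) \<and>
           ((\<lambda>\<epsilon>. Linf_norm (ball 0 (1/2)) (u \<epsilon>) /
                 E_norm (r * real CARD('n)) (ball 0 1) (u \<epsilon>)) \<longlongrightarrow> \<infinity>) (at_right 0)) \<and>
        (\<forall>\<epsilon>. 0 < \<epsilon> \<and> \<epsilon> < \<epsilon>\<^sub>0 \<longrightarrow>
           ess_sup (ball 0 (1/8)) (u \<epsilon>) < \<infinity> \<and> 0 < ess_inf (ball 0 (1/8)) (u \<epsilon>)) \<and>
        ((\<lambda>\<epsilon>. ess_sup (ball 0 (1/8)) (u \<epsilon>) / ess_inf (ball 0 (1/8)) (u \<epsilon>)) \<longlongrightarrow> \<infinity>)
          (at_right 0)) \<and>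
     (\<forall>r::real. 1 \<le> r \<longrightarrow>
        \<not> (\<exists>C :: real \<Rightarrow> real. mono_on {0..} C \<and>
             (\<forall>(u :: real ^ 'n \<Rightarrow> real) V.
                positive_W0_solution V u \<and> V \<in> LlogL r (ball 0 1) \<longrightarrow>
                Linf_norm (ball 0 (1/2)) u
                  \<le> ereal (C (real_of_ereal (N_norm r (ball 0 1) V)))
                     * E_norm (real CARD('n) * r) (ball 0 1) u))) \<and>
     (\<forall>r::real. 1 \<le> r \<longrightarrow>
        \<not> (\<exists>C :: real \<Rightarrow> real. mono_on {0..} C \<and>
             (\<forall>(u :: real ^ 'n \<Rightarrow> real) V.
                positive_W0_solution V u \<and> V \<in> LlogL r (ball 0 1) \<longrightarrow>
                ess_sup (ball 0 (1/8)) u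
                  \<le> ereal (C (real_of_ereal (N_norm r (ball 0 1) V)))
                     * ess_inf (ball 0 (1/8)) u))) \<and>
     \<not> (\<exists>C :: real \<Rightarrow> real. mono_on {0..} C \<and>
          (\<forall>(u :: real ^ 'n \<Rightarrow> real) V.
             positive_W0_solution V u \<and> in_Lp 1 (ball 0 1) V \<longrightarrow>
             ess_sup (ball 0 (1/8)) u
               \<le> ereal (C (Lp_norm 1 (ball 0 1) V)) * ess_inf (ball 0 (1/8)) u))"
proof -
  let ?n = "CARD('n)" and ?B = "ball 0 1 :: (real^'n) set"
  let ?u = "moser :: real \<Rightarrow> real^'n \<Rightarrow> real"
  let ?V = "moser_potential :: real \<Rightarrow> real^'n \<Rightarrow> real"
  let ?A = "ball 0 (1/8) :: (real^'n) set" and ?H = "ball 0 (1/2) :: (real^'n) set"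
  have fam: "moser_family TYPE('n) \<epsilon>" if "0 < \<epsilon>" "\<epsilon> < 1/8" for \<epsilon>
    using that assms by unfold_locales
  note facts = moser_family.positive_solution[OF fam] moser_family.V_in_LlogL[OF fam]
    moser_family.N_norm_V_le[OF fam] moser_family.V_in_L1[OF fam] moser_family.L1_norm_V_le[OF fam]
  have ev: "\<forall>\<^sub>F \<epsilon> in at_right 0. P \<epsilon>" if "\<And>\<epsilon>. 0 < \<epsilon> \<Longrightarrow> \<epsilon> < 1/8 \<Longrightarrow> P \<epsilon>" for P :: "real \<Rightarrow> bool"
    unfolding eventually_at_right_field by (rule exI[of _ "1/8"]) (auto intro: that)
  have sup: "ereal (- ln \<epsilon>) \<le> ess_sup ?A (?u \<epsilon>)" "ess_sup ?A (?u \<epsilon>) < \<infinity>"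
    "Linf_norm ?H (?u \<epsilon>) < \<infinity>" if "0 < \<epsilon>" "\<epsilon> < 1/8" for \<epsilon>
    using moser_family.ess_sup_u[OF fam[OF that], of "1/8"]
      moser_family.ess_sup_u[OF fam[OF that], of "1/2"] that by auto
  have inf: "0 < ess_inf ?A (?u \<epsilon>)" "ess_inf ?A (?u \<epsilon>) \<le> ereal (ln 16)"
    if "0 < \<epsilon>" "\<epsilon> < 1/8" for \<epsilon>
    using moser_family.ess_inf_u[OF fam[OF that]] by auto
  have inf': "ess_inf ?A (?u \<epsilon>) < \<infinity>" if "0 < \<epsilon>" "\<epsilon> < 1/8" for \<epsilon>
    using inf(2)[OF that] by (rule le_less_trans) simp
  have E: "0 < E_norm (r * real ?n) ?B (?u \<epsilon>)" "E_norm (r * real ?n) ?B (?u \<epsilon>) < \<infinity>"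
    if "0 < \<epsilon>" "\<epsilon> < 1/8" "1 \<le> r" for \<epsilon> r
    using moser_family.E_norm_u[OF fam[OF that(1,2)] that(3)] by (auto intro: le_less_trans)
  have ln_top: "filterlim (\<lambda>\<epsilon>::real. - ln \<epsilon>) at_top (at_right 0)"
    using ln_at_0 by (simp add: filterlim_uminus_at_top)
  have limA: "((\<lambda>\<epsilon>. Linf_norm ?H (?u \<epsilon>) / E_norm (r * real ?n) ?B (?u \<epsilon>)) \<longlongrightarrow> \<infinity>) (at_right 0)"
    if r: "1 \<le> r" for r
  proof (rule tendsto_PInfty_lower_bound)
    define q where "q = r * real ?n / (real ?n - 1)"
    have "0 < r * real ?n" using r by simp
    then have q: "0 < q" using assms by (simp add: q_def)
    let ?c = "1 / (max 1 (4 * measure lborel ?B) * 2 powr (q - 1)) powr (1 / q)"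
    have "filterlim (\<lambda>\<epsilon>::real. (- ln \<epsilon>) powr (1 / q)) at_top (at_right 0)"
      by (rule filterlim_compose[OF real_powr_at_top ln_top]) (use q in simp)
    then show "filterlim (\<lambda>\<epsilon>. ?c * (- ln \<epsilon>) powr (1 / q)) at_top (at_right 0)"
      by (rule filterlim_tendsto_pos_mult_at_top[OF tendsto_const, rotated]) simp
    show "\<forall>\<^sub>F \<epsilon> in at_right 0. ereal (?c * (- ln \<epsilon>) powr (1 / q))
        \<le> Linf_norm ?H (?u \<epsilon>) / E_norm (r * real ?n) ?B (?u \<epsilon>)"
      unfolding q_def by (rule ev) (rule moser_family.ratio_ge[OF fam r])
  qed
  have limB: "((\<lambda>\<epsilon>. ess_sup ?A (?u \<epsilon>) / ess_inf ?A (?u \<epsilon>)) \<longlongrightarrow> \<infinity>) (at_right 0)"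
  proof (rule tendsto_PInfty_lower_bound)
    show "filterlim (\<lambda>\<epsilon>::real. (1 / ln 16) * - ln \<epsilon>) at_top (at_right 0)"
      by (rule filterlim_tendsto_pos_mult_at_top[OF tendsto_const _ ln_top]) simp
    show "\<forall>\<^sub>F \<epsilon> in at_right 0. ereal ((1 / ln 16) * - ln \<epsilon>) \<le> ess_sup ?A (?u \<epsilon>) / ess_inf ?A (?u \<epsilon>)"
    proof (rule ev)
      fix \<epsilon> :: real assume \<epsilon>: "0 < \<epsilon>" "\<epsilon> < 1/8"
      obtain i where i: "ess_inf ?A (?u \<epsilon>) = ereal i" "0 < i" "i \<le> ln 16"
        using inf[OF \<epsilon>] by (cases "ess_inf ?A (?u \<epsilon>)") auto
      obtain s where s: "ess_sup ?A (?u \<epsilon>) = ereal s" "- ln \<epsilon> \<le> s"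
        using sup[OF \<epsilon>] by (cases "ess_sup ?A (?u \<epsilon>)") auto
      have "- ln \<epsilon> / ln 16 \<le> s / i"
        using i s moser_family.ln_\<epsilon>[OF fam[OF \<epsilon>]] by (intro frac_le) auto
      then show "ereal ((1 / ln 16) * - ln \<epsilon>) \<le> ess_sup ?A (?u \<epsilon>) / ess_inf ?A (?u \<epsilon>)"
        using i s by simp
    qed
  qed
  have boundN: "\<exists>M. \<forall>\<^sub>F \<epsilon> in at_right 0. N_norm r ?B (?V \<epsilon>) \<le> ereal M" if "1 \<le> r" for r
    by (rule exI, rule ev) (rule facts(3)[OF _ _ that])
  have bound1: "\<exists>M. \<forall>\<^sub>F \<epsilon> in at_right 0. Lp_norm 1 ?B (?V \<epsilon>) \<le> M"
    by (rule exI, rule ev) (rule facts(5))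
  \<comment> \<open>The norm lies between 0 and a real number, so \<open>real_of_ereal\<close>
    returns its true value and not the default 0 for infinity; the result lies in the domain
    \<open>{0..}\<close> on which \<open>C\<close> is monotone.\<close>
  have realN: "\<exists>M. \<forall>\<^sub>F \<epsilon> in at_right 0. 0 \<le> real_of_ereal (N_norm r ?B (?V \<epsilon>)) \<and>
      real_of_ereal (N_norm r ?B (?V \<epsilon>)) \<le> M" if r: "1 \<le> r" for r
  proof -
    obtain M where "\<forall>\<^sub>F \<epsilon> in at_right 0. N_norm r ?B (?V \<epsilon>) \<le> ereal M"
      using boundN[OF r] by blast
    then have "\<forall>\<^sub>F \<epsilon> in at_right 0. 0 \<le> real_of_ereal (N_norm r ?B (?V \<epsilon>)) \<and>
      real_of_ereal (N_norm r ?B (?V \<epsilon>)) \<le> M"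
    proof eventually_elim
      case (elim \<epsilon>)
      moreover have "0 \<le> N_norm r ?B (?V \<epsilon>)"
        unfolding N_norm_def by (rule luxemburg_norm_nonneg)
      ultimately show ?case by (cases "N_norm r ?B (?V \<epsilon>)") auto
    qed
    then show ?thesis by blast
  qed
  have part1: "\<exists>(\<epsilon>\<^sub>0::real) (u :: real \<Rightarrow> real ^ 'n \<Rightarrow> real) (V :: real \<Rightarrow> real ^ 'n \<Rightarrow> real).
        0 < \<epsilon>\<^sub>0 \<and> \<epsilon>\<^sub>0 \<le> 1/8 \<and>
        (\<forall>\<epsilon>. 0 < \<epsilon> \<and> \<epsilon> < \<epsilon>\<^sub>0 \<longrightarrow> positive_W0_solution (V \<epsilon>) (u \<epsilon>)) \<and>
        (\<forall>r::real. 1 \<le> r \<longrightarrow>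
           (\<forall>\<epsilon>. 0 < \<epsilon> \<and> \<epsilon> < \<epsilon>\<^sub>0 \<longrightarrow> V \<epsilon> \<in> LlogL r (ball 0 1)) \<and>
           (\<exists>M::real. \<forall>\<^sub>F \<epsilon> in at_right 0. N_norm r (ball 0 1) (V \<epsilon>) \<le> ereal M)) \<and>
        (\<forall>\<epsilon>. 0 < \<epsilon> \<and> \<epsilon> < \<epsilon>\<^sub>0 \<longrightarrow> in_Lp 1 (ball 0 1) (V \<epsilon>)) \<and>
        (\<exists>M::real. \<forall>\<^sub>F \<epsilon> in at_right 0. Lp_norm 1 (ball 0 1) (V \<epsilon>) \<le> M) \<and>
        (\<forall>r::real. 1 \<le> r \<longrightarrow>
           (\<forall>\<epsilon>. 0 < \<epsilon> \<and> \<epsilon> < \<epsilon>\<^sub>0 \<longrightarrow>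
              Linf_norm (ball 0 (1/2)) (u \<epsilon>) < \<infinity> \<and>
              0 < E_norm (r * real CARD('n)) (ball 0 1) (u \<epsilon>) \<and>
              E_norm (r * real CARD('n)) (ball 0 1) (u \<epsilon>) < \<infinity>) \<and>
           ((\<lambda>\<epsilon>. Linf_norm (ball 0 (1/2)) (u \<epsilon>) /
                 E_norm (r * real CARD('n)) (ball 0 1) (u \<epsilon>)) \<longlongrightarrow> \<infinity>) (at_right 0)) \<and>
        (\<forall>\<epsilon>. 0 < \<epsilon> \<and> \<epsilon> < \<epsilon>\<^sub>0 \<longrightarrow>
           ess_sup (ball 0 (1/8)) (u \<epsilon>) < \<infinity> \<and> 0 < ess_inf (ball 0 (1/8)) (u \<epsilon>)) \<and>
        ((\<lambda>\<epsilon>. ess_sup (ball 0 (1/8)) (u \<epsilon>) / ess_inf (ball 0 (1/8)) (u \<epsilon>)) \<longlongrightarrow> \<infinity>)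
          (at_right 0)"
    by (rule exI[of _ "1/8"], rule exI[of _ ?u], rule exI[of _ ?V])
      (intro conjI allI impI; (elim conjE)?;
        (rule facts boundN bound1 sup inf E limA limB; assumption)?; simp)
  have part2: "\<not> (\<exists>C :: real \<Rightarrow> real. mono_on {0..} C \<and>
             (\<forall>(u :: real ^ 'n \<Rightarrow> real) V.
                positive_W0_solution V u \<and> V \<in> LlogL r (ball 0 1) \<longrightarrow>
                Linf_norm (ball 0 (1/2)) u
                  \<le> ereal (C (real_of_ereal (N_norm r (ball 0 1) V)))
                     * E_norm (real CARD('n) * r) (ball 0 1) u))" if r: "1 \<le> r" for r
  proof (intro notI, elim exE conjE)
    fix C :: "real \<Rightarrow> real"
    assume C: "mono_on {0..} C" and *: "\<forall>(u :: real ^ 'n \<Rightarrow> real) V.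
                positive_W0_solution V u \<and> V \<in> LlogL r (ball 0 1) \<longrightarrow>
                Linf_norm (ball 0 (1/2)) u
                  \<le> ereal (C (real_of_ereal (N_norm r (ball 0 1) V)))
                     * E_norm (real CARD('n) * r) (ball 0 1) u"
    obtain M where M: "\<forall>\<^sub>F \<epsilon> in at_right 0. 0 \<le> real_of_ereal (N_norm r ?B (?V \<epsilon>)) \<and>
      real_of_ereal (N_norm r ?B (?V \<epsilon>)) \<le> M" using realN[OF r] by blast
    have "\<forall>\<^sub>F \<epsilon> in at_right 0. Linf_norm ?H (?u \<epsilon>)
        \<le> ereal (C (real_of_ereal (N_norm r ?B (?V \<epsilon>)))) * E_norm (r * real ?n) ?B (?u \<epsilon>)"
      by (rule ev) (use * facts(1,2) r in \<open>simp add: mult.commute\<close>)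
    then show False
      using not_monotone_bound[OF limA[OF r] _ ev M C] E[OF _ _ r] by simp
  qed
  have part3: "\<not> (\<exists>C :: real \<Rightarrow> real. mono_on {0..} C \<and>
             (\<forall>(u :: real ^ 'n \<Rightarrow> real) V.
                positive_W0_solution V u \<and> V \<in> LlogL r (ball 0 1) \<longrightarrow>
                ess_sup (ball 0 (1/8)) u
                  \<le> ereal (C (real_of_ereal (N_norm r (ball 0 1) V)))
                     * ess_inf (ball 0 (1/8)) u))" if r: "1 \<le> r" for r
  proof (intro notI, elim exE conjE)
    fix C :: "real \<Rightarrow> real"
    assume C: "mono_on {0..} C" and *: "\<forall>(u :: real ^ 'n \<Rightarrow> real) V.
                positive_W0_solution V u \<and> V \<in> LlogL r (ball 0 1) \<longrightarrow>
                ess_sup (ball 0 (1/8)) u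
                  \<le> ereal (C (real_of_ereal (N_norm r (ball 0 1) V)))
                     * ess_inf (ball 0 (1/8)) u"
    obtain M where M: "\<forall>\<^sub>F \<epsilon> in at_right 0. 0 \<le> real_of_ereal (N_norm r ?B (?V \<epsilon>)) \<and>
      real_of_ereal (N_norm r ?B (?V \<epsilon>)) \<le> M" using realN[OF r] by blast
    have "\<forall>\<^sub>F \<epsilon> in at_right 0. ess_sup ?A (?u \<epsilon>)
        \<le> ereal (C (real_of_ereal (N_norm r ?B (?V \<epsilon>)))) * ess_inf ?A (?u \<epsilon>)"
      by (rule ev) (use * facts(1,2) r in simp)
    then show False
      using not_monotone_bound[OF limB _ ev M C] inf inf' by simp
  qed
  have part4: "\<not> (\<exists>C :: real \<Rightarrow> real. mono_on {0..} C \<and>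
          (\<forall>(u :: real ^ 'n \<Rightarrow> real) V.
             positive_W0_solution V u \<and> in_Lp 1 (ball 0 1) V \<longrightarrow>
             ess_sup (ball 0 (1/8)) u
               \<le> ereal (C (Lp_norm 1 (ball 0 1) V)) * ess_inf (ball 0 (1/8)) u))"
  proof (intro notI, elim exE conjE)
    fix C :: "real \<Rightarrow> real"
    assume C: "mono_on {0..} C" and *: "\<forall>(u :: real ^ 'n \<Rightarrow> real) V.
             positive_W0_solution V u \<and> in_Lp 1 (ball 0 1) V \<longrightarrow>
             ess_sup (ball 0 (1/8)) u
               \<le> ereal (C (Lp_norm 1 (ball 0 1) V)) * ess_inf (ball 0 (1/8)) u"
    obtain M where "\<forall>\<^sub>F \<epsilon> in at_right 0. Lp_norm 1 ?B (?V \<epsilon>) \<le> M" using bound1 by blast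
    then have M: "\<forall>\<^sub>F \<epsilon> in at_right 0. 0 \<le> Lp_norm 1 ?B (?V \<epsilon>) \<and> Lp_norm 1 ?B (?V \<epsilon>) \<le> M"
      by (rule eventually_mono) (simp add: Lp_norm_def)
    have "\<forall>\<^sub>F \<epsilon> in at_right 0. ess_sup ?A (?u \<epsilon>)
        \<le> ereal (C (Lp_norm 1 ?B (?V \<epsilon>))) * ess_inf ?A (?u \<epsilon>)"
      by (rule ev) (use * facts(1,4) in simp)
    then show False
      using not_monotone_bound[OF limB _ ev M C] inf inf' by simp
  qed
  show ?thesis
    using part1 part2 part3 part4 by blast
qed

end
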